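(* There is a constant $c>0$, independent of $h$ and of the functions $y$, $p$, $\tilde p_h$ below, such that the following holds. Let $y\in L^2(\Gamma)$, let $p\in H^1_D(\Gamma)$ be the solution of $$a(w,p)=(y,w)_{L^2(\Gamma)}\qquad\forall w\in H^1_D(\Gamma),$$ and let $\tilde p_h\in V_{h,D}$ be its Ritz projection, i.e. $a(w_h,p-\tilde p_h)=0$ for all $w_h\in V_{h,D}$. Then, provided that $p\in H^2(\Gamma)$, $$|\mathcal K p-\mathcal K_h\tilde p_h|_2\le c\,h\,|p|_{H^2(\Gamma)}.$$
   Context: Metric graph: $G=(\mathcal V,\mathcal E)$ is a finite undirected graph; each edge $e\in\mathcal E$ joins two vertices and is identified with an interval $(0,L_e)$, $L_e>0$. $\Gamma$ denotes the resulting metric graph; $\mathcal E_v$ is the set of edges incident to $v$. The vertex set is split as $\mathcal V=\mathcal V_K\cup\mathcal V_D$ (disjoint), $n_D=|\mathcal V_D|$; vectors in $\mathbb R^{n_D}$ are indexed by $v\in\mathcal V_D$, and $|\cdot|_2$ is the Euclidean norm. Spaces: $L^2(\Gamma)=\prod_{e}L^2(e)$ with $(f,g)_{L^2(\Gamma)}=\sum_e\int_e fg\,dx$; $L^\infty(\Gamma)=\prod_e L^\infty(e)$; $H^1(\Gamma)$ is the set of $y\in\prod_e H^1(e)$ that are continuous on $\Gamma$ (values from all incident edges agree at each vertex), with $\|y\|_{H^1(\Gamma)}^2=\|y\|_{L^2(\Gamma)}^2+\sum_e\|y'\|_{L^2(e)}^2$; $H^1_D(\Gamma)=\{y\in H^1(\Gamma):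 y(v)=0\ \forall v\in\mathcal V_D\}$; $H^2(\Gamma)$ is the set of $y\in H^1(\Gamma)$ with $y|_e\in H^2(e)$ for all $e$, with seminorm $|y|_{H^2(\Gamma)}^2=\sum_e\|y''\|_{L^2(e)}^2$. Bilinear form: $c_0\in L^\infty(\Gamma)$, $c_0\ge0$ a.e., and $a(y,w)=\sum_{e}\int_e(y'w'+c_0\,y\,w)\,dx$. Standing assumption: $a$ is coercive on $H^1_D(\Gamma)$ (this holds e.g. if $G$ is connected and $\mathcal V_D\ne\emptyset$). Kirchhoff operator: for $p\in H^2(\Gamma)$, $\mathcal Kp\in\mathbb R^{n_D}$ has entries $(\mathcal Kp)(v)=\sum_{e\in\mathcal E_v}p|_e'(v)$, $v\in\mathcal V_D$, where $p|_e'(v)$ is the derivative at $v$ in the direction pointing out of $e$ (i.e. $p|_e'(L_e)$ if $v$ corresponds to $x_e=L_e$ and $-p|_e'(0)$ if $v$ corresponds to $x_e=0$). Discretization: each edge $e$ carries an equidistant grid of $n_e\ge1$ subintervals, whose first and last grid points are the endpoints of $e$; $h>0$ is the maximal length of all subintervals over all edges. $V_h$ is the space of continuous functions on $\Gamma$ that are affine on each subinterval, and $V_{h,D}=V_h\cap H^1_D(\Gamma)$. For $v\in\mathcal V$, $\phi_v\in V_h$ is the nodal basis function with $\phi_v(v)=1$ that vanishes at all other grid points. Discrete Kirchhoff operator: for $y\in L^2(\Gamma)$ let $P_h y=p_h\in V_{h,D}$ be defined by $a(w_h,p_h)=(y,w_h)_{L^2(\Gamma)}$ for all $w_h\in V_{h,D}$.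 For $p_h=P_h y$, $\mathcal K_hp_h\in\mathbb R^{n_D}$ is defined by $(\mathcal K_hp_h)(v)=a(\phi_v,p_h)-(y,\phi_v)_{L^2(\Gamma)}$, $v\in\mathcal V_D$; the datum $y$ is part of this definition. In the claim $\tilde p_h=P_hy$ and $\mathcal K_h\tilde p_h$ is formed with the datum $y$ of the claim. The constant $c$ may depend on the metric graph, on $\mathcal V_D$ and on $c_0$. *)

theory Defs
  imports "HOL-Analysis.Analysis"
begin

section \<open>Sobolev spaces on an interval\<close>

text \<open>Elements of Lebesgue and Sobolev spaces are represented by functions on the reals of which
  only the values on the interval matter.\<close>

definition L2_ivl :: "real \<Rightarrow> (real \<Rightarrow> real) set" where
  "L2_ivl L = {f. f \<in> borel_measurable (lebesgue_on {0<..<L}) \<and>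
                  integrable (lebesgue_on {0<..<L}) (\<lambda>x. (f x)\<^sup>2)}"

definition Linf_ivl :: "real \<Rightarrow> (real \<Rightarrow> real) set" where
  "Linf_ivl L = {f. f \<in> borel_measurable (lebesgue_on {0<..<L}) \<and>
                    (\<exists>C. AE x in lebesgue_on {0<..<L}. \<bar>f x\<bar> \<le> C)}"

text \<open>The space of compactly supported \<open>C\<^sup>1\<close> functions on \<open>(0, L)\<close>. Testing against this space is
  the definition of \<open>H\<^sup>1(0, L)\<close> in Brezis, Functional Analysis, Sobolev Spaces and Partial
  Differential Equations, Section 8.2.\<close>

definition test_functions :: "real \<Rightarrow> (real \<Rightarrow> real) set" where
  "test_functions L = {\<phi>. \<phi> C1_differentiable_on UNIV \<and> closure {x. \<phi> x \<noteq> 0} \<subseteq> {0<..<L}}"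

definition is_weak_deriv :: "real \<Rightarrow> (real \<Rightarrow> real) \<Rightarrow> (real \<Rightarrow> real) \<Rightarrow> bool" where
  "is_weak_deriv L f g \<longleftrightarrow> g \<in> L2_ivl L \<and>
     (\<forall>\<phi>\<in>test_functions L.
        (LINT x|lebesgue_on {0<..<L}. f x * deriv \<phi> x) =
        - (LINT x|lebesgue_on {0<..<L}. g x * \<phi> x))"

definition H1_ivl :: "real \<Rightarrow> (real \<Rightarrow> real) set" where
  "H1_ivl L = {f \<in> L2_ivl L. \<exists>g. is_weak_deriv L f g}"

text \<open>The weak derivative is unique up to null sets; this picks a representative.\<close>

definition weak_deriv :: "real \<Rightarrow> (real \<Rightarrow> real) \<Rightarrow> real \<Rightarrow> real" where
  "weak_deriv L f = (SOME g. is_weak_deriv L f g)"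

definition H2_ivl :: "real \<Rightarrow> (real \<Rightarrow> real) set" where
  "H2_ivl L = {f \<in> H1_ivl L. weak_deriv L f \<in> H1_ivl L}"


section \<open>Metric graphs and function spaces on them\<close>

text \<open>The edge \<open>e\<close> is identified with the interval \<open>(0, len e)\<close>, where \<open>0\<close> corresponds to \<open>tail e\<close>
  and \<open>len e\<close> to \<open>head e\<close>. The orientation only fixes this parametrization. Parallel edges and
  loops are allowed.\<close>

record ('v, 'e) metric_graph =
  verts :: "'v set"
  edges :: "'e set"
  tail :: "'e \<Rightarrow> 'v"
  head :: "'e \<Rightarrow> 'v"
  len :: "'e \<Rightarrow> real"

definition is_metric_graph :: "('v, 'e) metric_graph \<Rightarrow> bool" where
  "is_metric_graph \<Gamma> \<longleftrightarrow> finite (verts \<Gamma>) \<and> finite (edges \<Gamma>) \<and>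
     (\<forall>e\<in>edges \<Gamma>. tail \<Gamma> e \<in> verts \<Gamma> \<and> head \<Gamma> e \<in> verts \<Gamma> \<and> len \<Gamma> e > 0)"

definition incident_edges :: "('v, 'e) metric_graph \<Rightarrow> 'v \<Rightarrow> 'e set" where
  "incident_edges \<Gamma> v = {e \<in> edges \<Gamma>. tail \<Gamma> e = v \<or> head \<Gamma> e = v}"

type_synonym 'e graph_fun = "'e \<Rightarrow> real \<Rightarrow> real"

text \<open>\<open>f(v) = c\<close>: all edges incident to \<open>v\<close> give the value \<open>c\<close> at \<open>v\<close>.\<close>

definition has_vertex_value :: "('v, 'e) metric_graph \<Rightarrow> 'e graph_fun \<Rightarrow> 'v \<Rightarrow> real \<Rightarrow> bool" where
  "has_vertex_value \<Gamma> f v c \<longleftrightarrow>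
     (\<forall>e\<in>incident_edges \<Gamma> v.
        (tail \<Gamma> e = v \<longrightarrow> f e 0 = c) \<and> (head \<Gamma> e = v \<longrightarrow> f e (len \<Gamma> e) = c))"

definition continuous_graph_fun :: "('v, 'e) metric_graph \<Rightarrow> 'e graph_fun \<Rightarrow> bool" where
  "continuous_graph_fun \<Gamma> f \<longleftrightarrow>
     (\<forall>e\<in>edges \<Gamma>. continuous_on {0..len \<Gamma> e} (f e)) \<and>
     (\<forall>v\<in>verts \<Gamma>. \<exists>c. has_vertex_value \<Gamma> f v c)"

definition L2_graph :: "('v, 'e) metric_graph \<Rightarrow> 'e graph_fun set" where
  "L2_graph \<Gamma> = {f. \<forall>e\<in>edges \<Gamma>. f e \<in> L2_ivl (len \<Gamma> e)}"

definition L2_inner :: "('v, 'e) metric_graph \<Rightarrow> 'e graph_fun \<Rightarrow> 'e graph_fun \<Rightarrow> real" where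
  "L2_inner \<Gamma> f g = (\<Sum>e\<in>edges \<Gamma>. LINT x|lebesgue_on {0<..<len \<Gamma> e}. f e x * g e x)"

definition Linf_graph :: "('v, 'e) metric_graph \<Rightarrow> 'e graph_fun set" where
  "Linf_graph \<Gamma> = {f. \<forall>e\<in>edges \<Gamma>. f e \<in> Linf_ivl (len \<Gamma> e)}"

abbreviation graph_deriv :: "('v, 'e) metric_graph \<Rightarrow> 'e graph_fun \<Rightarrow> 'e graph_fun" where
  "graph_deriv \<Gamma> f \<equiv> (\<lambda>e. weak_deriv (len \<Gamma> e) (f e))"

text \<open>A function in \<open>H\<^sup>1(e)\<close> is represented by its representative that is continuous on the closed
  interval, so that the values at the vertices are ordinary function values.\<close>

definition H1_graph :: "('v, 'e) metric_graph \<Rightarrow> 'e graph_fun set" where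
  "H1_graph \<Gamma> = {f. (\<forall>e\<in>edges \<Gamma>. f e \<in> H1_ivl (len \<Gamma> e)) \<and> continuous_graph_fun \<Gamma> f}"

definition H1_norm :: "('v, 'e) metric_graph \<Rightarrow> 'e graph_fun \<Rightarrow> real" where
  "H1_norm \<Gamma> f =
     sqrt (L2_inner \<Gamma> f f + L2_inner \<Gamma> (graph_deriv \<Gamma> f) (graph_deriv \<Gamma> f))"

definition H1D_graph :: "('v, 'e) metric_graph \<Rightarrow> 'v set \<Rightarrow> 'e graph_fun set" where
  "H1D_graph \<Gamma> VD = {f \<in> H1_graph \<Gamma>. \<forall>v\<in>VD. has_vertex_value \<Gamma> f v 0}"

definition H2_graph :: "('v, 'e) metric_graph \<Rightarrow> 'e graph_fun set" where
  "H2_graph \<Gamma> = {f \<in> H1_graph \<Gamma>. \<forall>e\<in>edges \<Gamma>. f e \<in> H2_ivl (len \<Gamma> e)}"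

definition H2_seminorm :: "('v, 'e) metric_graph \<Rightarrow> 'e graph_fun \<Rightarrow> real" where
  "H2_seminorm \<Gamma> f =
     sqrt (L2_inner \<Gamma> (graph_deriv \<Gamma> (graph_deriv \<Gamma> f)) (graph_deriv \<Gamma> (graph_deriv \<Gamma> f)))"


section \<open>Bilinear form and Kirchhoff operator\<close>

definition bilin :: "('v, 'e) metric_graph \<Rightarrow> 'e graph_fun \<Rightarrow> 'e graph_fun \<Rightarrow> 'e graph_fun \<Rightarrow> real"
  where
  "bilin \<Gamma> c0 y w =
     (\<Sum>e\<in>edges \<Gamma>. LINT x|lebesgue_on {0<..<len \<Gamma> e}.
        graph_deriv \<Gamma> y e x * graph_deriv \<Gamma> w e x + c0 e x * y e x * w e x)"

definition coercive_on_H1D :: "('v, 'e) metric_graph \<Rightarrow> 'v set \<Rightarrow> 'e graph_fun \<Rightarrow> bool" where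
  "coercive_on_H1D \<Gamma> VD c0 \<longleftrightarrow>
     (\<exists>\<alpha>>0. \<forall>w\<in>H1D_graph \<Gamma> VD. bilin \<Gamma> c0 w w \<ge> \<alpha> * (H1_norm \<Gamma> w)\<^sup>2)"

text \<open>A function in \<open>H\<^sup>2(e)\<close> (given by its continuous representative) is \<open>C\<^sup>1\<close> on the closed
  interval, so the derivatives at the endpoints are the one-sided classical ones.
  A loop contributes both of its ends.\<close>

definition kirchhoff :: "('v, 'e) metric_graph \<Rightarrow> 'e graph_fun \<Rightarrow> 'v \<Rightarrow> real" where
  "kirchhoff \<Gamma> p v =
     (\<Sum>e\<in>incident_edges \<Gamma> v.
        (if head \<Gamma> e = v
         then vector_derivative (p e) (at (len \<Gamma> e) within {0..len \<Gamma> e}) else 0) +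
        (if tail \<Gamma> e = v
         then - vector_derivative (p e) (at 0 within {0..len \<Gamma> e}) else 0))"


section \<open>Discretization\<close>

text \<open>A discretization is given by the number \<open>n e\<close> of subintervals of each edge \<open>e\<close>.\<close>

definition grid_point :: "('v, 'e) metric_graph \<Rightarrow> ('e \<Rightarrow> nat) \<Rightarrow> 'e \<Rightarrow> nat \<Rightarrow> real" where
  "grid_point \<Gamma> n e i = real i * len \<Gamma> e / real (n e)"

definition mesh_size :: "('v, 'e) metric_graph \<Rightarrow> ('e \<Rightarrow> nat) \<Rightarrow> real" where
  "mesh_size \<Gamma> n = Max ((\<lambda>e. len \<Gamma> e / real (n e)) ` edges \<Gamma>)"

definition Vh :: "('v, 'e) metric_graph \<Rightarrow> ('e \<Rightarrow> nat) \<Rightarrow> 'e graph_fun set" where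
  "Vh \<Gamma> n = {f. continuous_graph_fun \<Gamma> f \<and>
     (\<forall>e\<in>edges \<Gamma>. \<forall>i<n e. \<exists>\<alpha> \<beta>.
        \<forall>x\<in>{grid_point \<Gamma> n e i..grid_point \<Gamma> n e (Suc i)}. f e x = \<alpha> + \<beta> * x)}"

definition VhD :: "('v, 'e) metric_graph \<Rightarrow> 'v set \<Rightarrow> ('e \<Rightarrow> nat) \<Rightarrow> 'e graph_fun set" where
  "VhD \<Gamma> VD n = Vh \<Gamma> n \<inter> H1D_graph \<Gamma> VD"

text \<open>The nodal basis function is unique on \<open>\<Gamma>\<close>, but not as a function on the reals.\<close>

definition nodal_basis :: "('v, 'e) metric_graph \<Rightarrow> ('e \<Rightarrow> nat) \<Rightarrow> 'v \<Rightarrow> 'e graph_fun" where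
  "nodal_basis \<Gamma> n v = (SOME \<phi>. \<phi> \<in> Vh \<Gamma> n \<and> has_vertex_value \<Gamma> \<phi> v 1 \<and>
     (\<forall>u\<in>verts \<Gamma> - {v}. has_vertex_value \<Gamma> \<phi> u 0) \<and>
     (\<forall>e\<in>edges \<Gamma>. \<forall>i\<in>{0<..<n e}. \<phi> e (grid_point \<Gamma> n e i) = 0))"

text \<open>The discrete Kirchhoff operator for \<open>p\<^sub>h = P\<^sub>h y\<close>; the datum \<open>y\<close> is an explicit argument.\<close>

definition kirchhoff_h ::
  "('v, 'e) metric_graph \<Rightarrow> 'e graph_fun \<Rightarrow> ('e \<Rightarrow> nat) \<Rightarrow> 'e graph_fun \<Rightarrow> 'e graph_fun \<Rightarrow> 'v \<Rightarrow> real"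
  where
  "kirchhoff_h \<Gamma> c0 n y ph v =
     bilin \<Gamma> c0 (nodal_basis \<Gamma> n v) ph - L2_inner \<Gamma> y (nodal_basis \<Gamma> n v)"

end

theory Submission
  imports Defs
begin

text \<open>
  The idea is to replace the nodal basis function \<open>\<phi>\<^sub>v\<close>, whose energy \<open>a(\<phi>\<^sub>v, \<phi>\<^sub>v)\<close> grows like
  \<open>1/h\<close> on refined grids, by the function \<open>w\<^sub>v\<close> that is affine on each whole edge, 1 at \<open>v\<close> and 0
  at the other vertices (\<open>edge_hat\<close>). It belongs to \<open>V\<^sub>h\<close> for every grid, its energy does not
  depend on the grid, and \<open>w\<^sub>v - \<phi>\<^sub>v\<close> vanishes at all vertices, hence lies in \<open>V\<^bsub>h,D\<^esub>\<close>. On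
  \<open>V\<^bsub>h,D\<^esub>\<close> the functionals \<open>a(\<cdot>, p\<^sub>h)\<close> and \<open>(y, \<cdot>)\<close> agree, so the discrete Kirchhoff operator can
  be evaluated with \<open>w\<^sub>v\<close> in place of \<open>\<phi>\<^sub>v\<close> (\<open>kirchhoff_h_variational\<close>): \<open>(K\<^sub>h p\<^sub>h)(v) = a(w\<^sub>v,
  p\<^sub>h) - (y, w\<^sub>v)\<close>. Testing the weak equation with functions supported in a single edge gives
  \<open>-p'' + c\<^sub>0 p = y\<close> almost everywhere (\<open>strong_form\<close>), and integrating \<open>a(w\<^sub>v, p)\<close> by parts
  gives the same representation \<open>(K p)(v) = a(w\<^sub>v, p) - (y, w\<^sub>v)\<close> (\<open>kirchhoff_variational\<close>).
  Therefore \<open>(K p - K\<^sub>h p\<^sub>h)(v) = a(w\<^sub>v, p - p\<^sub>h)\<close>.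

  Since \<open>c\<^sub>0 \<ge> 0\<close>, the form \<open>a\<close> is positive semidefinite and satisfies the Cauchy-Schwarz
  inequality, and the Ritz projection is a best approximation in the energy seminorm
  (\<open>galerkin_best_approximation\<close>). So the error is at most the energy seminorm of \<open>w\<^sub>v\<close> times
  that of the interpolation error of \<open>p\<close>, and the latter is of order \<open>h |p|\<close> in terms of the
  \<open>H\<^sup>2\<close> seminorm (\<open>interpolant_energy_error\<close>). No power of \<open>h\<close> is lost, since the energy of \<open>w\<^sub>v\<close>
  is a constant.

  The analysis on a single edge rests on one characterization: a continuous function has a weak
  derivative \<open>g\<close> in \<open>L\<^sup>2\<close> if and only if it is, up to a constant, the indefinite integral of \<open>g\<close>
  (\<open>primitive_on\<close>, with \<open>H1_primitive\<close> and \<open>primitive_on_weak_deriv\<close>). It follows from the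
  fundamental lemma of the calculus of variations, the lemma of du Bois-Reymond and integration
  by parts for indefinite integrals, and it turns statements about \<open>weak_deriv\<close> into statements
  about explicit derivatives (\<open>bilin_primitives\<close>).
\<close>

section \<open>Square integrable functions on an edge\<close>

abbreviation (input) edge_measure :: "real \<Rightarrow> real measure" where
  "edge_measure L \<equiv> lebesgue_on {0<..<L}"

lemma finite_measure_edge: "finite_measure (edge_measure L)"
  by (intro finite_measure_lebesgue_on lmeasurable_open) auto

lemma integrable_edge_iff: "integrable (edge_measure L) f \<longleftrightarrow> f absolutely_integrable_on {0..L}"
  for f :: "real \<Rightarrow> real"
proof -
  have "integrable (edge_measure L) f \<longleftrightarrow> f absolutely_integrable_on {0<..<L}"
    unfolding set_integrable_def by (rule integrable_restrict_space) simp
  then show ?thesis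
    by (simp add: absolutely_integrable_on_Icc_iff_Ioo)
qed

lemma LINT_edge:
  fixes f :: "real \<Rightarrow> real"
  assumes "integrable (edge_measure L) f"
  shows "(LINT x|edge_measure L. f x) = integral {0..L} f"
  using lebesgue_integral_eq_integral[OF assms] by (simp add: integral_open_interval_real)

lemma L2_mult_integrable:
  assumes "f \<in> L2_ivl L" "g \<in> L2_ivl L"
  shows "integrable (edge_measure L) (\<lambda>x. f x * g x)"
proof (rule Bochner_Integration.integrable_bound)
  show "integrable (edge_measure L) (\<lambda>x. (f x)\<^sup>2 + (g x)\<^sup>2)"
    using assms by (auto simp: L2_ivl_def)
  show "(\<lambda>x. f x * g x) \<in> borel_measurable (edge_measure L)"
    using assms by (auto simp: L2_ivl_def)
  have "\<bar>a * b\<bar> \<le> a\<^sup>2 + b\<^sup>2" for a b :: real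
  proof -
    have "2 * (\<bar>a\<bar> * \<bar>b\<bar>) \<le> a\<^sup>2 + b\<^sup>2"
      using sum_squares_bound[of "\<bar>a\<bar>" "\<bar>b\<bar>"] by simp
    moreover have "0 \<le> \<bar>a\<bar> * \<bar>b\<bar>"
      by simp
    ultimately show ?thesis
      unfolding abs_mult by linarith
  qed
  then show "AE x in edge_measure L. norm (f x * g x) \<le> norm ((f x)\<^sup>2 + (g x)\<^sup>2)"
    by (auto intro!: AE_I2)
qed

lemma const_L2: "(\<lambda>x. c) \<in> L2_ivl L"
  using finite_measure.integrable_const[OF finite_measure_edge] by (auto simp: L2_ivl_def)

lemma L2_integrable:
  assumes "f \<in> L2_ivl L"
  shows "integrable (edge_measure L) f"
  using L2_mult_integrable[OF assms const_L2[of 1]] by simp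

lemma L2_add_scaled:
  assumes "f \<in> L2_ivl L" "g \<in> L2_ivl L"
  shows "(\<lambda>x. f x + t * g x) \<in> L2_ivl L"
proof -
  have "(\<lambda>x. (f x + t * g x)\<^sup>2) = (\<lambda>x. (f x)\<^sup>2 + 2 * t * (f x * g x) + t\<^sup>2 * (g x)\<^sup>2)"
    by (auto simp: power2_eq_square algebra_simps)
  then show ?thesis
    using assms L2_mult_integrable[OF assms] by (auto simp: L2_ivl_def)
qed

lemma Linf_mult_L2:
  assumes "c \<in> Linf_ivl L" "f \<in> L2_ivl L"
  shows "(\<lambda>x. c x * f x) \<in> L2_ivl L"
proof -
  obtain C where C: "AE x in edge_measure L. \<bar>c x\<bar> \<le> C"
    and meas: "c \<in> borel_measurable (edge_measure L)" "f \<in> borel_measurable (edge_measure L)"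
    and int: "integrable (edge_measure L) (\<lambda>x. (f x)\<^sup>2)"
    using assms by (auto simp: Linf_ivl_def L2_ivl_def)
  have "integrable (edge_measure L) (\<lambda>x. (c x * f x)\<^sup>2)"
  proof (rule Bochner_Integration.integrable_bound)
    show "integrable (edge_measure L) (\<lambda>x. C\<^sup>2 * (f x)\<^sup>2)"
      using int by auto
    show "AE x in edge_measure L. norm ((c x * f x)\<^sup>2) \<le> norm (C\<^sup>2 * (f x)\<^sup>2)"
      using C
    proof eventually_elim
      case (elim x)
      then have "(c x)\<^sup>2 \<le> C\<^sup>2"
        using abs_le_square_iff by fastforce
      then show ?case
        by (simp add: power_mult_distrib mult_right_mono)
    qed
  qed (use meas in auto)
  then show ?thesis
    using meas by (auto simp: L2_ivl_def)
qed

lemma bounded_measurable_L2: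
  assumes "f \<in> borel_measurable (edge_measure L)" "\<And>x. x \<in> {0<..<L} \<Longrightarrow> \<bar>f x\<bar> \<le> C"
  shows "f \<in> L2_ivl L"
proof -
  have "f \<in> Linf_ivl L"
    using assms by (auto simp: Linf_ivl_def intro!: exI[of _ C] AE_I2)
  from Linf_mult_L2[OF this const_L2[of 1]] show ?thesis
    by simp
qed

lemma continuous_L2:
  assumes "continuous_on {0..L} f"
  shows "f \<in> L2_ivl L"
proof -
  have "compact (f ` {0..L})"
    using assms by (intro compact_continuous_image) auto
  then have "bounded (f ` {0..L})"
    by (rule compact_imp_bounded)
  then obtain C where "\<And>x. x \<in> {0..L} \<Longrightarrow> \<bar>f x\<bar> \<le> C"
    unfolding bounded_iff real_norm_def by blast
  moreover have "f \<in> borel_measurable (edge_measure L)"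
    by (rule continuous_imp_measurable_on_sets_lebesgue)
       (use assms in \<open>auto intro: continuous_on_subset\<close>)
  ultimately show ?thesis
    by (intro bounded_measurable_L2[of f L C]) auto
qed

lemma L2_integrable_on:
  fixes g :: "real \<Rightarrow> real"
  assumes "integrable (edge_measure L) g" "0 \<le> a" "b \<le> L"
  shows "g integrable_on {a..b}" "(\<lambda>x. \<bar>g x\<bar>) integrable_on {a..b}"
proof -
  have "g absolutely_integrable_on {0..L}"
    using assms integrable_edge_iff by blast
  then have "g absolutely_integrable_on {a..b}"
    by (rule absolutely_integrable_on_subinterval) (use assms in auto)
  then show "g integrable_on {a..b}" "(\<lambda>x. \<bar>g x\<bar>) integrable_on {a..b}"
    by (auto simp: absolutely_integrable_on_def)
qed

section \<open>The fundamental lemma of the calculus of variations\<close>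

text \<open>By Lebesgue's differentiation theorem, \<open>f x\<close> is the limit of the averages of \<open>f\<close> over
  \<open>[x, x + h]\<close> for almost every \<open>x\<close>, and these averages vanish for
  small \<open>h\<close>.\<close>

lemma AE_zero_if_interval_integrals_zero:
  fixes f :: "real \<Rightarrow> real"
  assumes int: "integrable (edge_measure L) f"
    and zero: "\<And>a b. 0 < a \<Longrightarrow> a < b \<Longrightarrow> b < L \<Longrightarrow> integral {a..b} f = 0"
  shows "AE x in edge_measure L. f x = 0"
proof -
  define F where "F = (\<lambda>x. if x \<in> {0<..<L} then f x else 0)"
  have "f integrable_on {0<..<L}"
    using int by (simp add: integrable_on_lebesgue_on)
  then have "F integrable_on UNIV"
    unfolding F_def by (subst integrable_restrict_UNIV)
  then have "F integrable_on cbox a b" for a b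
    by (rule integrable_on_subcbox) simp
  then obtain N where N: "negligible N"
    and lim: "\<And>x e. \<lbrakk>x \<notin> N; 0 < e\<rbrakk> \<Longrightarrow> \<exists>d>0. \<forall>h. 0 < h \<and> h < d \<longrightarrow>
      norm (integral (cbox x (x + h *\<^sub>R One)) F /\<^sub>R h ^ DIM(real) - F x) < e"
    by (rule integrable_ccontinuous_explicit) blast
  have "f x = 0" if x: "x \<in> {0<..<L}" "x \<notin> N" for x
  proof (rule ccontr)
    assume "f x \<noteq> 0"
    then obtain d where "d > 0" and d: "\<And>h. 0 < h \<Longrightarrow> h < d \<Longrightarrow>
      norm (integral (cbox x (x + h *\<^sub>R One)) F /\<^sub>R h ^ DIM(real) - F x) < \<bar>f x\<bar>"
      using lim[OF x(2), of "\<bar>f x\<bar>"] by auto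
    define h where "h = min (d / 2) ((L - x) / 2)"
    have h: "0 < h" "h < d" "x + h < L"
      using \<open>d > 0\<close> x by (auto simp: h_def min_def field_simps)
    have "integral {x..x + h} F = integral {x..x + h} f"
      by (rule integral_cong) (use x h in \<open>auto simp: F_def\<close>)
    then have "integral {x..x + h} F = 0"
      using zero[of x "x + h"] x h by simp
    then show False
      using d[OF h(1,2)] x by (simp add: F_def)
  qed
  then have "AE x in lebesgue. x \<in> {0<..<L} \<longrightarrow> f x = 0"
    using N by (intro AE_I'[of N]) (auto simp: negligible_iff_null_sets)
  then show ?thesis
    by (subst AE_restrict_space_iff) auto
qed

lemma test_functionD:
  assumes "\<eta> \<in> test_functions L"
  shows "\<And>x. (\<eta> has_real_derivative deriv \<eta> x) (at x)"
    and "continuous_on UNIV (deriv \<eta>)"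
    and "\<And>x. x \<notin> {0<..<L} \<Longrightarrow> \<eta> x = 0"
proof -
  obtain D where D: "\<And>x. (\<eta> has_real_derivative D x) (at x)" and cont: "continuous_on UNIV D"
    using assms by (auto simp: test_functions_def C1_differentiable_on_def
        has_real_derivative_iff_has_vector_derivative)
  have "deriv \<eta> = D"
    using D DERIV_imp_deriv by blast
  then show "\<And>x. (\<eta> has_real_derivative deriv \<eta> x) (at x)" "continuous_on UNIV (deriv \<eta>)"
    using D cont by auto
  have "{x. \<eta> x \<noteq> 0} \<subseteq> {0<..<L}"
    using assms closure_subset[of "{x. \<eta> x \<noteq> 0}"] by (auto simp: test_functions_def)
  then show "\<And>x. x \<notin> {0<..<L} \<Longrightarrow> \<eta> x = 0"
    by blast
qed

lemma test_functionI:
  assumes "\<And>x. (\<eta> has_real_derivative D x) (at x)" "continuous_on UNIV D"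
    and "\<And>x. \<eta> x \<noteq> 0 \<Longrightarrow> x \<in> {a..b}" "0 < a" "b < L"
  shows "\<eta> \<in> test_functions L"
proof -
  have "closure {x. \<eta> x \<noteq> 0} \<subseteq> {a..b}"
    using assms(3) by (intro closure_minimal) auto
  then show ?thesis
    using assms unfolding test_functions_def C1_differentiable_on_def
      has_real_derivative_iff_has_vector_derivative by fastforce
qed

lemma test_function_continuous:
  assumes "\<eta> \<in> test_functions L"
  shows "continuous_on S \<eta>"
  by (intro continuous_at_imp_continuous_on ballI DERIV_isCont[OF test_functionD(1)[OF assms]])

text \<open>Squaring the positive part is what makes the bump function below continuously differentiable
  at the end points of its support.\<close>

lemma has_derivative_max0_square: "((\<lambda>t. (max 0 t)\<^sup>2) has_real_derivative 2 * max 0 t) (at t)"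
  for t :: real
proof -
  consider "t > 0" | "t < 0" | "t = 0" by linarith
  then show ?thesis
  proof cases
    case 1
    have "((\<lambda>t. t\<^sup>2) has_real_derivative 2 * t) (at t)"
      by (auto intro!: derivative_eq_intros)
    then have "((\<lambda>t. (max 0 t)\<^sup>2) has_real_derivative 2 * t) (at t)"
      by (rule has_field_derivative_transform_within_open[of _ _ _ "{0<..}"]) (use 1 in auto)
    then show ?thesis using 1 by simp
  next
    case 2
    have "((\<lambda>t. 0) has_real_derivative 0) (at t)"
      by auto
    then have "((\<lambda>t. (max 0 t)\<^sup>2) has_real_derivative 0) (at t)"
      by (rule has_field_derivative_transform_within_open[of _ _ _ "{..<0}"]) (use 2 in auto)
    then show ?thesis using 2 by simp
  next
    case 3
    have "((\<lambda>h. (max 0 h)\<^sup>2 / h) \<longlongrightarrow> 0) (at (0::real))"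
    proof (rule Lim_null_comparison[OF always_eventually])
      show "\<forall>h. norm ((max 0 h)\<^sup>2 / h) \<le> \<bar>h::real\<bar>"
        by (auto simp: max_def power2_eq_square)
      show "((\<lambda>h. \<bar>h::real\<bar>) \<longlongrightarrow> 0) (at 0)"
        by (auto intro!: tendsto_eq_intros)
    qed
    then show ?thesis
      using 3 by (simp add: DERIV_def)
  qed
qed

text \<open>The bump is the squared positive part of the parabola \<open>(x - a) (b - x)\<close>. The normalization
  by \<open>(b - a)\<^sup>2\<close> bounds it by \<open>1/16\<close>; the strict bound by 1 is what the powers in the proof of the
  fundamental lemma need.\<close>

lemma bump_exists:
  fixes a b :: real
  assumes "a < b"
  obtains q D where "\<And>x. (q has_real_derivative D x) (at x)" "continuous_on UNIV D"
    "\<And>x. 0 \<le> q x" "\<And>x. q x < 1" "\<And>x. q x > 0 \<longleftrightarrow> x \<in> {a<..<b}"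
proof -
  define m where "m = (\<lambda>x. (x - a) * (b - x) / (b - a)\<^sup>2)"
  define q where "q = (\<lambda>x. (max 0 (m x))\<^sup>2)"
  define D where "D = (\<lambda>x. 2 * max 0 (m x) * ((a + b - 2 * x) / (b - a)\<^sup>2))"
  have m': "(m has_real_derivative ((a + b - 2 * x) / (b - a)\<^sup>2)) (at x)" for x
    unfolding m_def using assms by (auto intro!: derivative_eq_intros simp: field_simps)
  have "(q has_real_derivative D x) (at x)" for x
    unfolding q_def D_def by (rule DERIV_chain2[OF has_derivative_max0_square m'])
  moreover have "continuous_on UNIV D"
    unfolding D_def m_def using assms by (intro continuous_intros) auto
  moreover have "0 \<le> q x" for x
    by (simp add: q_def)
  moreover have "q x < 1" for x
  proof -
    have "4 * ((x - a) * (b - x)) \<le> (b - a)\<^sup>2"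
      using zero_le_power2[of "(x - a) - (b - x)"] by (simp add: power2_eq_square algebra_simps)
    then have "m x < 1"
      using assms by (simp add: m_def divide_less_eq) (smt (verit) zero_less_power2)
    then have "max 0 (m x) < 1" by simp
    then show ?thesis
      unfolding q_def by (simp add: power_less_one_iff)
  qed
  moreover have "q x > 0 \<longleftrightarrow> x \<in> {a<..<b}" for x
  proof -
    have "q x > 0 \<longleftrightarrow> m x > 0"
      by (auto simp: q_def zero_less_power2 max_def)
    also have "\<dots> \<longleftrightarrow> 0 < (x - a) * (b - x)"
      using assms by (simp add: m_def zero_less_divide_iff)
    also have "\<dots> \<longleftrightarrow> x \<in> {a<..<b}"
      using assms by (auto simp: zero_less_mult_iff)
    finally show ?thesis .
  qed
  ultimately show thesis
    using that by blast
qed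

text \<open>If \<open>q\<close> is a bump on \<open>(a, b)\<close> with values in \<open>[0, 1)\<close>, then the test functions
  \<open>1 - (1 - q)\<^sup>n\<close> converge boundedly to the indicator function of \<open>(a, b)\<close>. So \<open>f\<close> has integral zero
  over every \<open>[a, b]\<close> inside \<open>(0, L)\<close>.\<close>

lemma fundamental_lemma:
  fixes f :: "real \<Rightarrow> real"
  assumes int: "integrable (edge_measure L) f"
    and zero: "\<And>\<eta>. \<eta> \<in> test_functions L \<Longrightarrow> (LINT x|edge_measure L. f x * \<eta> x) = 0"
  shows "AE x in edge_measure L. f x = 0"
proof (rule AE_zero_if_interval_integrals_zero[OF int])
  fix a b :: real
  assume ab: "0 < a" "a < b" "b < L"
  obtain q D where q': "\<And>x. (q has_real_derivative D x) (at x)" and D: "continuous_on UNIV D"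
    and q: "\<And>x. 0 \<le> q x" "\<And>x. q x < 1" "\<And>x. q x > 0 \<longleftrightarrow> x \<in> {a<..<b}"
    using bump_exists[OF ab(2)] by blast
  have q_cont: "continuous_on UNIV q"
    by (intro continuous_at_imp_continuous_on ballI DERIV_isCont[OF q'])
  define \<eta> where "\<eta> = (\<lambda>n x. 1 - (1 - q x) ^ n)"
  have test: "\<eta> n \<in> test_functions L" for n
  proof (rule test_functionI)
    show "(\<eta> n has_real_derivative real n * (1 - q x) ^ (n - 1) * D x) (at x)" for x
      unfolding \<eta>_def using q' by (auto intro!: derivative_eq_intros)
    show "continuous_on UNIV (\<lambda>x. real n * (1 - q x) ^ (n - 1) * D x)"
      by (intro continuous_intros D q_cont)
    show "\<And>x. \<eta> n x \<noteq> 0 \<Longrightarrow> x \<in> {a..b}"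
      using q(1) q(3) unfolding \<eta>_def
      by (metis atLeastAtMost_iff cancel_comm_monoid_add_class.diff_cancel diff_zero
          greaterThanLessThan_iff less_eq_real_def power_one)
  qed (use ab in auto)
  have lim: "(\<lambda>n. \<eta> n x) \<longlonglongrightarrow> indicat_real {a<..<b} x" for x
  proof (cases "x \<in> {a<..<b}")
    case True
    then have "q x > 0" using q(3) by blast
    then have "(\<lambda>n. (1 - q x) ^ n) \<longlonglongrightarrow> 0"
      using q(2)[of x] by (intro LIMSEQ_power_zero) (simp add: \<open>q x > 0\<close> abs_if)
    then have "(\<lambda>n. 1 - (1 - q x) ^ n) \<longlonglongrightarrow> 1 - 0"
      by (rule tendsto_diff[OF tendsto_const])
    then show ?thesis using True by (simp add: \<eta>_def)
  next
    case False
    then have "q x = 0" using q(1,3) by (metis less_eq_real_def)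
    then show ?thesis using False by (simp add: \<eta>_def)
  qed
  have bound: "\<bar>\<eta> n x\<bar> \<le> 1" for n x
    using q(1,2)[of x] power_le_one[of "1 - q x" n] zero_le_power[of "1 - q x" n]
    by (simp add: \<eta>_def)
  have meas: "f \<in> borel_measurable (edge_measure L)"
    using int by auto
  have \<eta>_meas: "\<eta> n \<in> borel_measurable (edge_measure L)" for n
    by (rule continuous_imp_measurable_on_sets_lebesgue)
       (use test_function_continuous[OF test] in auto)
  have "(\<lambda>n. LINT x|edge_measure L. f x * \<eta> n x) \<longlonglongrightarrow>
      (LINT x|edge_measure L. f x * indicat_real {a<..<b} x)"
  proof (rule integral_dominated_convergence)
    show "integrable (edge_measure L) (\<lambda>x. \<bar>f x\<bar>)" using int by auto
    show "AE x in edge_measure L. norm (f x * \<eta> n x) \<le> \<bar>f x\<bar>" for n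
      using bound mult_left_le[OF bound] by (auto intro!: AE_I2 simp: abs_mult)
    show "AE x in edge_measure L. (\<lambda>n. f x * \<eta> n x) \<longlonglongrightarrow> f x * indicat_real {a<..<b} x"
      by (intro AE_I2 tendsto_intros lim)
    show "(\<lambda>x. f x * indicat_real {a<..<b} x) \<in> borel_measurable (edge_measure L)"
      by (intro borel_measurable_times meas borel_measurable_indicator)
        (use ab in \<open>auto simp: sets_restrict_space_iff\<close>)
    show "(\<lambda>x. f x * \<eta> n x) \<in> borel_measurable (edge_measure L)" for n
      by (intro borel_measurable_times meas \<eta>_meas)
  qed
  then have "(LINT x|edge_measure L. f x * indicat_real {a<..<b} x) = 0"
    using zero[OF test] by (simp add: LIMSEQ_const_iff)
  moreover have "(LINT x|edge_measure L. f x * indicat_real {a<..<b} x)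
      = integral {0..L} (\<lambda>x. f x * indicat_real {a<..<b} x)"
    by (intro LINT_edge integrable_real_mult_indicator int)
       (use ab in \<open>auto simp: sets_restrict_space_iff\<close>)
  moreover have "integral {0..L} (\<lambda>x. f x * indicat_real {a<..<b} x) = integral {a<..<b} f"
  proof -
    have "(\<lambda>x. f x * indicat_real {a<..<b} x) = (\<lambda>x. if x \<in> {a<..<b} then f x else 0)"
      by auto
    moreover have "{a<..<b} \<inter> {0..L} = {a<..<b}"
      using ab by auto
    ultimately show ?thesis
      using Henstock_Kurzweil_Integration.integral_restrict_Int[of "{0..L}" "{a<..<b}" f]
      by (simp only: Int_commute)
  qed
  ultimately show "integral {a..b} f = 0"
    by (simp add: integral_open_interval_real)
qed

section \<open>Integration by parts for indefinite integrals\<close>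

text \<open>Fubini's theorem is used for the product of Borel measures, so integrals over an edge have to
  be rewritten as integrals with respect to \<open>lborel\<close>.\<close>

lemma lborel_edge:
  fixes f f' :: "real \<Rightarrow> real"
  assumes f': "f' \<in> borel_measurable lborel"
    and AE: "AE x in lebesgue. f' x = indicator {0<..<L} x * f x"
  shows "(LINT x|lborel. f' x) = (LINT x|edge_measure L. f x)"
    and "integrable lborel f' \<longleftrightarrow> integrable (edge_measure L) f"
proof -
  have f'_leb: "f' \<in> borel_measurable lebesgue"
    using f' by (rule measurable_completion)
  have f_leb: "(\<lambda>x. indicator {0<..<L} x * f x) \<in> borel_measurable lebesgue"
    by (rule borel_measurable_AE[OF f'_leb AE])
  have "(LINT x|lborel. f' x) = (LINT x|lebesgue. f' x)"
    by (rule integral_completion[OF f', symmetric])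
  also have "\<dots> = (LINT x|lebesgue. indicator {0<..<L} x * f x)"
    by (rule integral_cong_AE[OF f'_leb f_leb AE])
  also have "\<dots> = (LINT x|edge_measure L. f x)"
    by (subst integral_restrict_space) auto
  finally show "(LINT x|lborel. f' x) = (LINT x|edge_measure L. f x)" .
  have "integrable lborel f' \<longleftrightarrow> integrable lebesgue f'"
    by (rule integrable_completion[OF f', symmetric])
  also have "\<dots> \<longleftrightarrow> integrable lebesgue (\<lambda>x. indicator {0<..<L} x * f x)"
    by (rule integrable_cong_AE[OF f'_leb f_leb AE])
  also have "\<dots> \<longleftrightarrow> integrable (edge_measure L) f"
    by (subst integrable_restrict_space) auto
  finally show "integrable lborel f' \<longleftrightarrow> integrable (edge_measure L) f" .
qed

text \<open>The product rule is not at hand, because \<open>G\<close> need not be differentiable everywhere. Instead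
  both \<open>G x - G 0\<close> and \<open>\<phi> L - \<phi> t\<close> are written as integrals of their derivatives, and the order of
  integration of \<open>g t * \<phi>' x\<close> over the triangle \<open>t \<le> x\<close> is exchanged.\<close>

lemma integration_by_parts_edge:
  assumes g: "g \<in> L2_ivl L" and L: "0 < L"
    and G: "\<And>x. x \<in> {0..L} \<Longrightarrow> G x = G 0 + integral {0..x} g"
    and \<phi>: "\<And>x. x \<in> {0..L} \<Longrightarrow> (\<phi> has_real_derivative \<phi>' x) (at x within {0..L})"
    and \<phi>': "continuous_on {0..L} \<phi>'"
  shows "(LINT x|edge_measure L. G x * \<phi>' x) =
      G L * \<phi> L - G 0 * \<phi> 0 - (LINT x|edge_measure L. g x * \<phi> x)"
proof -
  have \<phi>'_int: "(\<phi>' has_integral (\<phi> L - \<phi> x)) {x..L}" if "x \<in> {0..L}" for x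
  proof (rule fundamental_theorem_of_calculus)
    show "(\<phi> has_vector_derivative \<phi>' t) (at t within {x..L})" if "t \<in> {x..L}" for t
      using \<phi>[of t] that \<open>x \<in> {0..L}\<close>
      by (auto simp: has_real_derivative_iff_has_vector_derivative[symmetric]
          intro: has_field_derivative_subset)
  qed (use that in auto)
  have \<phi>_cont: "continuous_on {0..L} \<phi>"
    using \<phi> by (meson DERIV_continuous continuous_on_eq_continuous_within)
  have G_cont: "continuous_on {0..L} G"
  proof (rule continuous_on_eq)
    show "continuous_on {0..L} (\<lambda>x. G 0 + integral {0..x} g)"
      by (intro continuous_intros indefinite_integral_continuous_1
          L2_integrable_on[OF L2_integrable[OF g]]) auto
  qed (rule G[symmetric])
  note L2 = g continuous_L2[OF \<phi>_cont] continuous_L2[OF \<phi>'] continuous_L2[OF G_cont]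
  \<comment> \<open>Borel measurable versions of \<open>\<phi>'\<close> and \<open>g\<close> that live on the whole line.\<close>
  define k where "k = (\<lambda>x. indicator {0..L} x * \<phi>' x)"
  have k_int: "integrable lborel k"
    using borel_integrable_atLeastAtMost'[OF \<phi>'] by (simp add: k_def set_integrable_def)
  have "integrable lebesgue (\<lambda>x. indicator {0<..<L} x *\<^sub>R g x)"
    using L2_integrable[OF g] by (subst (asm) integrable_restrict_space) auto
  then have "(\<lambda>x. indicator {0<..<L} x * g x) \<in> borel_measurable lebesgue"
    by auto
  then obtain g' where g'_meas: "g' \<in> borel_measurable lborel"
    and g': "AE x in lborel. indicator {0<..<L} x * g x = g' x"
    using completion_ex_borel_measurable_real by blast
  have g'_ae: "AE x in lebesgue. g' x = indicator {0<..<L} x * g x"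
    using AE_completion[OF g'] by eventually_elim simp
  have g'_int: "integrable lborel g'"
    using lborel_edge(2)[OF g'_meas g'_ae] L2_integrable[OF g] by blast
  have k_meas: "k \<in> borel_measurable lborel"
    using k_int by auto
  note [measurable] = k_meas g'_meas
  \<comment> \<open>The integrand on the triangle \<open>t \<le> x\<close>; the factors \<open>g'\<close> and \<open>k\<close> vanish outside \<open>[0, L]\<close>
    (almost everywhere).\<close>
  define F where "F = (\<lambda>t x. if t \<le> x then g' t * k x else 0)"
  have F_meas: "case_prod F \<in> borel_measurable (lborel \<Otimes>\<^sub>M lborel)"
    unfolding F_def by measurable
  have F_int: "integrable (lborel \<Otimes>\<^sub>M lborel) (case_prod F)"
  proof (rule Bochner_Integration.integrable_bound[OF _ F_meas])
    show "integrable (lborel \<Otimes>\<^sub>M lborel) (\<lambda>(t, x). g' t * k x)"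
    proof (rule lborel_pair.Fubini_integrable)
      have "(LINT x|lborel. norm (g' t * k x)) = \<bar>g' t\<bar> * (LINT x|lborel. \<bar>k x\<bar>)" for t
        by (simp add: abs_mult)
      then show "integrable lborel (\<lambda>t. LINT x|lborel. norm (case (t, x) of (t, x) \<Rightarrow> g' t * k x))"
        using g'_int by simp
    qed (use k_int in \<open>measurable, auto\<close>)
    show "AE p in lborel \<Otimes>\<^sub>M lborel. norm (case_prod F p) \<le> norm (case p of (t, x) \<Rightarrow> g' t * k x)"
      by (rule AE_I2) (auto simp: F_def)
  qed
  have F_int1: "(LINT x|lborel. F t x) = g' t * (\<phi> L - \<phi> t)" if t: "t \<in> {0<..<L}" for t
  proof -
    have F_eq: "F t = (\<lambda>x. if x \<in> {t..L} then g' t * \<phi>' x else 0)"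
      using t by (auto simp: F_def k_def fun_eq_iff)
    have "((\<lambda>x. g' t * \<phi>' x) has_integral g' t * (\<phi> L - \<phi> t)) {t..L}"
      using t by (intro has_integral_mult_right \<phi>'_int) auto
    then have "(F t has_integral g' t * (\<phi> L - \<phi> t)) UNIV"
      unfolding F_eq by (simp only: has_integral_restrict_UNIV)
    moreover have "integrable lborel (F t)"
    proof (rule Bochner_Integration.integrable_bound)
      show "integrable lborel (\<lambda>x. g' t * k x)" using k_int by auto
      show "F t \<in> borel_measurable lborel" unfolding F_def by measurable
    qed (auto simp: F_def)
    then have "(F t has_integral (LINT x|lborel. F t x)) UNIV"
      by (rule has_integral_integral_lborel)
    ultimately show ?thesis
      using has_integral_unique by blast
  qed
  have F_int2: "(LINT t|lborel. F t x) = k x * (G x - G 0)" if x: "x \<in> {0<..<L}" for x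
  proof -
    define f' where "f' = (\<lambda>t. indicator {..x} t * g' t)"
    have "AE t in lebesgue. t \<noteq> x"
      by (rule AE_completion[OF AE_lborel_singleton])
    with g'_ae have ae: "AE t in lebesgue. f' t = indicator {0<..<x} t * g t"
      by eventually_elim (use x in \<open>auto simp: f'_def indicator_def\<close>)
    have meas: "f' \<in> borel_measurable lborel"
      unfolding f'_def by measurable
    have "g absolutely_integrable_on {0..x}"
      using L2_integrable[OF g] x unfolding integrable_edge_iff
      by (elim absolutely_integrable_on_subinterval) auto
    then have "integrable (edge_measure x) g"
      by (simp add: integrable_edge_iff)
    then have "(LINT t|lborel. f' t) = integral {0..x} g"
      using lborel_edge(1)[OF meas ae] LINT_edge by simp
    moreover have "(\<lambda>t. F t x) = (\<lambda>t. k x * f' t)"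
      by (auto simp: F_def f'_def)
    ultimately show ?thesis
      using G[of x] x by simp
  qed
  have "(LINT x|lborel. LINT t|lborel. F t x) = (LINT t|lborel. LINT x|lborel. F t x)"
    by (rule lborel_pair.Fubini_integral[OF F_int])
  moreover have "(LINT t|lborel. LINT x|lborel. F t x) = (LINT t|edge_measure L. g t * (\<phi> L - \<phi> t))"
  proof (rule lborel_edge(1))
    show "(\<lambda>t. LINT x|lborel. F t x) \<in> borel_measurable lborel"
      using lborel_pair.integrable_fst'[OF F_int] by auto
    show "AE t in lebesgue. (LINT x|lborel. F t x) = indicator {0<..<L} t * (g t * (\<phi> L - \<phi> t))"
      using g'_ae
    proof eventually_elim
      case (elim t)
      show ?case
      proof (cases "t \<in> {0<..<L}")
        case True
        then show ?thesis using elim F_int1[OF True] by simp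
      next
        case False
        then have "g' t = 0" using elim by (auto simp: indicator_def)
        then have "F t = (\<lambda>x. 0)" by (auto simp: F_def)
        then show ?thesis using False by simp
      qed
    qed
  qed
  moreover have "(LINT x|lborel. LINT t|lborel. F t x) =
      (LINT x|edge_measure L. \<phi>' x * (G x - G 0))"
  proof (rule lborel_edge(1))
    show "(\<lambda>x. LINT t|lborel. F t x) \<in> borel_measurable lborel"
      using lborel_pair.integrable_snd[OF F_int] by auto
    have "AE x in lebesgue. x \<noteq> 0" "AE x in lebesgue. x \<noteq> L"
      by (rule AE_completion[OF AE_lborel_singleton])+
    then show "AE x in lebesgue. (LINT t|lborel. F t x) =
        indicator {0<..<L} x * (\<phi>' x * (G x - G 0))"
    proof eventually_elim
      case (elim x)
      show ?case
      proof (cases "x \<in> {0<..<L}")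
        case True
        then show ?thesis using F_int2[OF True] by (simp add: k_def)
      next
        case False
        then have "k x = 0" using elim by (auto simp: k_def indicator_def)
        then have "(\<lambda>t. F t x) = (\<lambda>t. 0)" by (auto simp: F_def)
        then show ?thesis using False by simp
      qed
    qed
  qed
  moreover have "(LINT t|edge_measure L. g t * (\<phi> L - \<phi> t)) =
      (G L - G 0) * \<phi> L - (LINT x|edge_measure L. g x * \<phi> x)"
  proof -
    have "(LINT t|edge_measure L. g t) = G L - G 0"
      using LINT_edge[OF L2_integrable[OF g]] G[of L] L by simp
    then show ?thesis
      using L2_mult_integrable[OF L2(1,2)] L2_integrable[OF g]
      by (simp add: right_diff_distrib)
  qed
  moreover have "(LINT x|edge_measure L. \<phi>' x * (G x - G 0)) =
      (LINT x|edge_measure L. G x * \<phi>' x) - G 0 * (\<phi> L - \<phi> 0)"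
  proof -
    have "(LINT x|edge_measure L. \<phi>' x) = \<phi> L - \<phi> 0"
      using LINT_edge[OF L2_integrable[OF L2(3)]] \<phi>'_int[of 0] L by (simp add: integral_unique)
    moreover have "(LINT x|edge_measure L. \<phi>' x * (G x - G 0)) =
        (LINT x|edge_measure L. G x * \<phi>' x) - G 0 * (LINT x|edge_measure L. \<phi>' x)"
      using L2_mult_integrable[OF L2(4,3)] L2_integrable[OF L2(3)]
      by (simp add: algebra_simps)
    ultimately show ?thesis by simp
  qed
  ultimately show ?thesis
    by (simp add: algebra_simps)
qed

section \<open>Weakly differentiable functions are indefinite integrals\<close>

definition primitive_on :: "real \<Rightarrow> (real \<Rightarrow> real) \<Rightarrow> (real \<Rightarrow> real) \<Rightarrow> bool" where
  "primitive_on L F g \<longleftrightarrow> g \<in> L2_ivl L \<and> (\<forall>x\<in>{0..L}. F x = F 0 + integral {0..x} g)"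

lemma primitive_onD:
  assumes "primitive_on L F g"
  shows "g \<in> L2_ivl L" and "x \<in> {0..L} \<Longrightarrow> F x = F 0 + integral {0..x} g"
  using assms unfolding primitive_on_def by blast+

lemma primitive_on_continuous:
  assumes "primitive_on L F g"
  shows "continuous_on {0..L} F"
proof (rule continuous_on_eq)
  show "continuous_on {0..L} (\<lambda>x. F 0 + integral {0..x} g)"
    by (intro continuous_intros indefinite_integral_continuous_1
        L2_integrable_on(1)[OF L2_integrable[OF primitive_onD(1)[OF assms]]]) auto
qed (rule primitive_onD(2)[OF assms, symmetric])

lemma primitive_on_weak_deriv:
  assumes "primitive_on L F g" "0 < L"
  shows "is_weak_deriv L F g"
  unfolding is_weak_deriv_def
proof (intro conjI ballI)
  show g: "g \<in> L2_ivl L"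
    by (rule primitive_onD(1)[OF assms(1)])
  fix \<phi> assume \<phi>: "\<phi> \<in> test_functions L"
  have "(LINT x|edge_measure L. F x * deriv \<phi> x) =
      F L * \<phi> L - F 0 * \<phi> 0 - (LINT x|edge_measure L. g x * \<phi> x)"
  proof (rule integration_by_parts_edge[OF g assms(2)])
    show "F x = F 0 + integral {0..x} g" if "x \<in> {0..L}" for x
      using assms(1) that unfolding primitive_on_def by blast
    show "(\<phi> has_real_derivative deriv \<phi> x) (at x within {0..L})" for x
      by (rule has_field_derivative_at_within[OF test_functionD(1)[OF \<phi>]])
    show "continuous_on {0..L} (deriv \<phi>)"
      by (rule continuous_on_subset[OF test_functionD(2)[OF \<phi>]]) simp
  qed
  then show "(LINT x|edge_measure L. F x * deriv \<phi> x) = - (LINT x|edge_measure L. g x * \<phi> x)"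
    using test_functionD(3)[OF \<phi>, of 0] test_functionD(3)[OF \<phi>, of L] by simp
qed

lemma weak_deriv_unique:
  assumes "is_weak_deriv L f g" "is_weak_deriv L f g'"
  shows "AE x in edge_measure L. g x = g' x"
proof -
  have L2: "g \<in> L2_ivl L" "g' \<in> L2_ivl L"
    using assms by (auto simp: is_weak_deriv_def)
  have "AE x in edge_measure L. g x - g' x = 0"
  proof (rule fundamental_lemma)
    show "integrable (edge_measure L) (\<lambda>x. g x - g' x)"
      using L2 L2_integrable by blast
    fix \<eta> assume \<eta>: "\<eta> \<in> test_functions L"
    then have "\<eta> \<in> L2_ivl L"
      by (intro continuous_L2 test_function_continuous)
    then have "(LINT x|edge_measure L. (g x - g' x) * \<eta> x) =
        (LINT x|edge_measure L. g x * \<eta> x) - (LINT x|edge_measure L. g' x * \<eta> x)"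
      by (simp add: left_diff_distrib L2 L2_mult_integrable)
    then show "(LINT x|edge_measure L. (g x - g' x) * \<eta> x) = 0"
      using assms \<eta> by (simp add: is_weak_deriv_def)
  qed
  then show ?thesis
    by eventually_elim simp
qed

lemma weak_deriv_is_weak_deriv:
  assumes "f \<in> H1_ivl L"
  shows "is_weak_deriv L f (weak_deriv L f)"
proof -
  obtain g where "is_weak_deriv L f g"
    using assms by (auto simp: H1_ivl_def)
  then show ?thesis
    using someI[of "is_weak_deriv L f" g] by (simp add: weak_deriv_def)
qed

text \<open>The bounds are the infimum and the supremum of the support. For \<open>\<eta> = 0\<close> any numbers \<open>a > 0\<close>
  and \<open>b < L\<close> will do, so no relation between \<open>a\<close> and \<open>b\<close> is claimed.\<close>

lemma test_function_support:
  assumes "\<eta> \<in> test_functions L"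
  obtains a b where "0 < a" "b < L" "\<And>x. \<eta> x \<noteq> 0 \<Longrightarrow> x \<in> {a..b}"
proof (cases "{x. \<eta> x \<noteq> 0} = {}")
  case True
  then show ?thesis
    using that[of 1 "L - 1"] by simp
next
  case False
  define K where "K = closure {x. \<eta> x \<noteq> 0}"
  have K: "K \<subseteq> {0<..<L}" "closed K" "K \<noteq> {}" "{x. \<eta> x \<noteq> 0} \<subseteq> K"
    using assms False closure_subset[of "{x. \<eta> x \<noteq> 0}"]
    by (auto simp: K_def test_functions_def)
  have bdd: "bdd_below K" "bdd_above K"
    using K(1) by (auto intro!: bdd_belowI[of K 0] bdd_aboveI[of K L])
  show ?thesis
  proof
    show "0 < Inf K" "Sup K < L"
      using closed_contains_Inf[OF K(3) bdd(1) K(2)] closed_contains_Sup[OF K(3) bdd(2) K(2)] K(1)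
      by auto
    show "x \<in> {Inf K..Sup K}" if "\<eta> x \<noteq> 0" for x
      using that K(4) cInf_lower[OF _ bdd(1)] cSup_upper[OF _ bdd(2)] by auto
  qed
qed

text \<open>The antiderivative that vanishes at 0 is zero to the left of the support of \<open>D\<close>; to the right of
  it, it equals the integral of \<open>D\<close>, so it has compact support exactly if that integral vanishes.\<close>

lemma mean_zero_test_function_antiderivative:
  assumes D: "continuous_on UNIV D" and supp: "\<And>x. D x \<noteq> 0 \<Longrightarrow> x \<in> {a..b}" "0 < a" "b < L"
    and L: "0 < L" and mean: "integral {0..L} D = 0"
  obtains \<zeta> where "\<zeta> \<in> test_functions L" "deriv \<zeta> = D"
proof -
  define \<zeta> where "\<zeta> = (\<lambda>x. integral {0..x} D)"
  have int: "D integrable_on {u..v}" for u v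
    by (rule integrable_continuous_real) (rule continuous_on_subset[OF D], simp)
  have D0: "x < a \<or> b < x \<Longrightarrow> D x = 0" for x
    using supp(1)[of x] by fastforce
  have zero_int: "integral {u..v} D = 0" if "\<And>x. x \<in> {u..v} \<Longrightarrow> D x = 0" for u v
    using integral_cong[of "{u..v}" D "\<lambda>x. 0"] that by simp
  have \<zeta>': "(\<zeta> has_real_derivative D x) (at x)" for x
  proof -
    \<comment> \<open>On \<open>[-M, M]\<close>, which contains \<open>x\<close> in its interior, \<open>\<zeta>\<close> is an integral with fixed lower limit
      also for negative arguments.\<close>
    define M where "M = \<bar>x\<bar> + 1"
    have "\<zeta> t = integral {-M..t} D" if "t \<in> {-M..M}" for t
    proof (cases "0 \<le> t")
      case True
      have "integral {-M..0} D = 0"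
        by (intro zero_int D0) (use supp(2,3) in auto)
      then show ?thesis
        using Henstock_Kurzweil_Integration.integral_combine[OF _ True int, of "-M"]
        by (simp add: \<zeta>_def M_def)
    next
      case False
      then have "integral {-M..t} D = 0"
        by (intro zero_int D0) (use supp(2,3) in auto)
      then show ?thesis
        using False by (simp add: \<zeta>_def)
    qed
    moreover have "((\<lambda>t. integral {-M..t} D) has_real_derivative D x) (at x within {-M..M})"
      by (rule integral_has_real_derivative) (auto intro: continuous_on_subset[OF D] simp: M_def)
    ultimately have "(\<zeta> has_real_derivative D x) (at x within {-M..M})"
      using has_field_derivative_transform_within[of "\<lambda>t. integral {-M..t} D" "D x" x "{-M..M}" 1 \<zeta>]
      by (simp add: M_def abs_if)
    moreover have "at x within {-M..M} = at x"
      by (rule at_within_interior) (auto simp: M_def)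
    ultimately show ?thesis by simp
  qed
  have "\<zeta> \<in> test_functions L"
  proof (rule test_functionI[OF \<zeta>' D])
    fix x assume "\<zeta> x \<noteq> 0"
    have "a \<le> x"
    proof (rule ccontr)
      assume "\<not> a \<le> x"
      then have "\<zeta> x = 0"
        unfolding \<zeta>_def by (intro zero_int D0) (use supp(2,3) in auto)
      then show False using \<open>\<zeta> x \<noteq> 0\<close> by simp
    qed
    moreover have "x \<le> b"
    proof (rule ccontr)
      assume x: "\<not> x \<le> b"
      show False
      proof (cases "x \<le> L")
        case True
        have "integral {x..L} D = 0"
          by (intro zero_int D0) (use supp(2,3) x in auto)
        then have "\<zeta> x = integral {0..L} D"
          using Henstock_Kurzweil_Integration.integral_combine[OF _ True int, of 0] \<open>a \<le> x\<close> supp(2)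
          by (simp add: \<zeta>_def)
        then show False using mean \<open>\<zeta> x \<noteq> 0\<close> by simp
      next
        case False
        have "integral {L..x} D = 0"
          by (intro zero_int D0) (use supp(2,3) in auto)
        then have "\<zeta> x = integral {0..L} D"
          using Henstock_Kurzweil_Integration.integral_combine[OF _ _ int, of 0 L x] False L
          by (simp add: \<zeta>_def)
        then show False using mean \<open>\<zeta> x \<noteq> 0\<close> by simp
      qed
    qed
    ultimately show "x \<in> {a..b}" by simp
  qed (use supp in auto)
  moreover have "deriv \<zeta> = D"
    using \<zeta>' DERIV_imp_deriv by blast
  ultimately show thesis ..
qed

lemma test_function_mean_one:
  assumes "0 < L"
  obtains \<psi> where "\<psi> \<in> test_functions L" "(LINT x|edge_measure L. \<psi> x) = 1"
proof -
  obtain q D where q': "\<And>x. (q has_real_derivative D x) (at x)" and D: "continuous_on UNIV D"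
    and q: "\<And>x. 0 \<le> q x" "\<And>x. q x < 1" "\<And>x. q x > 0 \<longleftrightarrow> x \<in> {L/3<..<2*L/3}"
    using bump_exists[of "L/3" "2*L/3"] assms by auto
  have cont: "continuous_on {0..L} q"
    by (intro continuous_at_imp_continuous_on ballI DERIV_isCont[OF q'])
  have int: "integrable (edge_measure L) q"
    by (rule L2_integrable[OF continuous_L2[OF cont]])
  define c where "c = integral {0..L} q"
  have "q (L/2) > 0"
    using q(3) assms by simp
  moreover have "q (L/2) = 0" if "c = 0"
    using that integral_eq_0_iff[OF cont] q(1) assms unfolding c_def by simp
  ultimately have "c \<noteq> 0"
    by auto
  show thesis
  proof
    have "q x / c \<noteq> 0 \<Longrightarrow> x \<in> {L/3..2*L/3}" for x
      using q(1,3)[of x] by (auto simp: less_le)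
    then show "(\<lambda>x. q x / c) \<in> test_functions L"
      using assms \<open>c \<noteq> 0\<close>
      by (intro test_functionI[where D = "\<lambda>x. D x / c" and a = "L/3" and b = "2*L/3"]
          continuous_intros D DERIV_cdivide q') auto
    show "(LINT x|edge_measure L. q x / c) = 1"
      using LINT_edge[OF int] \<open>c \<noteq> 0\<close> by (simp add: c_def)
  qed
qed

text \<open>The lemma of du Bois-Reymond. Fix a test function \<open>\<psi>\<close> with integral 1. For every test function
  \<open>\<eta>\<close> with integral \<open>m\<close>, the function \<open>\<eta> - m \<psi>\<close> is the derivative of a test function, so \<open>u\<close> is
  orthogonal to it. This means that \<open>u - k\<close> is orthogonal to \<open>\<eta>\<close>, where \<open>k\<close> is the integral of
  \<open>u \<psi>\<close>.\<close>

lemma zero_weak_deriv_imp_const: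
  assumes u: "u \<in> L2_ivl L" and L: "0 < L"
    and zero: "\<And>\<zeta>. \<zeta> \<in> test_functions L \<Longrightarrow> (LINT x|edge_measure L. u x * deriv \<zeta> x) = 0"
  obtains k where "AE x in edge_measure L. u x = k"
proof -
  obtain \<psi> where \<psi>: "\<psi> \<in> test_functions L" and \<psi>1: "(LINT x|edge_measure L. \<psi> x) = 1"
    using test_function_mean_one[OF L] .
  have L2: "\<eta> \<in> L2_ivl L" if "\<eta> \<in> test_functions L" for \<eta>
    using that by (intro continuous_L2 test_function_continuous)
  define k where "k = (LINT x|edge_measure L. u x * \<psi> x)"
  have "AE x in edge_measure L. u x - k = 0"
  proof (rule fundamental_lemma)
    show "integrable (edge_measure L) (\<lambda>x. u x - k)"
      using L2_integrable[OF u] L2_integrable[OF const_L2] by auto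
    fix \<eta> assume \<eta>: "\<eta> \<in> test_functions L"
    define m where "m = (LINT x|edge_measure L. \<eta> x)"
    define D where "D = (\<lambda>x. \<eta> x - m * \<psi> x)"
    obtain a b where ab: "0 < a" "b < L" "\<And>x. \<eta> x \<noteq> 0 \<Longrightarrow> x \<in> {a..b}"
      using test_function_support[OF \<eta>] by blast
    obtain a' b' where ab': "0 < a'" "b' < L" "\<And>x. \<psi> x \<noteq> 0 \<Longrightarrow> x \<in> {a'..b'}"
      using test_function_support[OF \<psi>] by blast
    have D_int: "integrable (edge_measure L) D"
      unfolding D_def by (intro Bochner_Integration.integrable_diff integrable_mult_right
        L2_integrable L2 \<eta> \<psi>)
    have "(LINT x|edge_measure L. D x) = m - m * 1"
      unfolding D_def m_def \<psi>1[symmetric] using L2_integrable[OF L2] \<eta> \<psi> by simp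
    then have "integral {0..L} D = 0"
      using LINT_edge[OF D_int] by simp
    moreover have "continuous_on UNIV D"
      unfolding D_def by (intro continuous_intros test_function_continuous[OF \<eta>]
        test_function_continuous[OF \<psi>])
    moreover have "x \<in> {min a a'..max b b'}" if "D x \<noteq> 0" for x
    proof -
      have "\<eta> x \<noteq> 0 \<or> \<psi> x \<noteq> 0"
        using that by (auto simp: D_def)
      then show ?thesis
        using ab(3)[of x] ab'(3)[of x] by auto
    qed
    ultimately obtain \<zeta> where \<zeta>: "\<zeta> \<in> test_functions L" "deriv \<zeta> = D"
      using mean_zero_test_function_antiderivative[of D "min a a'" "max b b'" L] ab ab' L by auto
    have "(LINT x|edge_measure L. (u x - k) * \<eta> x) = (LINT x|edge_measure L. u x * \<eta> x) - k * m"
      using L2_mult_integrable[OF u L2[OF \<eta>]] L2_integrable[OF L2[OF \<eta>]]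
      by (simp add: left_diff_distrib m_def)
    also have "\<dots> = (LINT x|edge_measure L. u x * D x)"
      using L2_mult_integrable[OF u L2[OF \<eta>]] L2_mult_integrable[OF u L2[OF \<psi>]]
      by (simp add: D_def right_diff_distrib k_def mult.left_commute[of _ m])
    also have "\<dots> = 0"
      using zero[OF \<zeta>(1)] by (simp add: \<zeta>(2))
    finally show "(LINT x|edge_measure L. (u x - k) * \<eta> x) = 0" .
  qed
  then show thesis
    by (intro that[of k]) auto
qed

text \<open>The difference of \<open>f\<close> and the indefinite integral of \<open>g\<close> has weak derivative zero.\<close>

lemma weak_deriv_imp_primitive:
  assumes "f \<in> L2_ivl L" "is_weak_deriv L f g" "0 < L"
  obtains F where "primitive_on L F g" "AE x in edge_measure L. f x = F x"
proof -
  have g: "g \<in> L2_ivl L"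
    using assms by (simp add: is_weak_deriv_def)
  define G where "G = (\<lambda>x. integral {0..x} g)"
  have G: "primitive_on L G g"
    by (simp add: primitive_on_def G_def g)
  have G_L2: "G \<in> L2_ivl L"
    by (rule continuous_L2[OF primitive_on_continuous[OF G]])
  have "(LINT x|edge_measure L. (f x + (-1) * G x) * deriv \<zeta> x) =
      0" if \<zeta>: "\<zeta> \<in> test_functions L" for \<zeta>
  proof -
    have "deriv \<zeta> \<in> L2_ivl L"
      using test_functionD(2)[OF \<zeta>] by (intro continuous_L2) (auto intro: continuous_on_subset)
    then have "(LINT x|edge_measure L. (f x + (-1) * G x) * deriv \<zeta> x) =
        (LINT x|edge_measure L. f x * deriv \<zeta> x) - (LINT x|edge_measure L. G x * deriv \<zeta> x)"
      by (simp add: left_diff_distrib L2_mult_integrable assms G_L2)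
    also have "\<dots> = 0"
      using assms(2) primitive_on_weak_deriv[OF G \<open>0 < L\<close>] \<zeta> by (simp add: is_weak_deriv_def)
    finally show ?thesis .
  qed
  then obtain k where k: "AE x in edge_measure L. f x + (-1) * G x = k"
    using zero_weak_deriv_imp_const[OF L2_add_scaled[OF assms(1) G_L2, of "-1"] assms(3)] by blast
  show thesis
  proof
    show "primitive_on L (\<lambda>x. G x + k) g"
      using G by (simp add: primitive_on_def G_def)
    show "AE x in edge_measure L. f x = G x + k"
      using k by eventually_elim simp
  qed
qed

lemma continuous_AE_eq_imp_eq:
  assumes "continuous_on {0..L} f" "continuous_on {0..L} g" "AE x in edge_measure L. f x = g x"
    "0 < L" "x \<in> {0..L}"
  shows "f x = (g x :: real)"
proof -
  define h where "h = (\<lambda>x. f x - g x)"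
  have h: "continuous_on {0..L} h"
    unfolding h_def by (intro continuous_on_diff assms(1,2))
  have "closed {x \<in> {0..L}. h x = 0}"
    by (rule continuous_closed_preimage_constant[OF h]) simp
  moreover have "AE x in lebesgue. x \<in> {0<..<L} \<longrightarrow> x \<in> {x \<in> {0..L}. h x = 0}"
  proof -
    have "AE x in lebesgue. x \<in> {0<..<L} \<longrightarrow> f x = g x"
      using assms(3) by (subst (asm) AE_restrict_space_iff) auto
    then show ?thesis
      by eventually_elim (auto simp: h_def)
  qed
  ultimately have "h y = 0" if "y \<in> {0<..<L}" for y
    using mem_closed_if_AE_lebesgue_open[of "{0<..<L}" "{x \<in> {0..L}. h x = 0}" y] that by auto
  then have "h x = 0"
    using continuous_constant_on_closure[of "{0<..<L}" h 0 x] h assms(4,5) by auto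
  then show ?thesis
    by (simp add: h_def)
qed

lemma H1_primitive:
  assumes "f \<in> H1_ivl L" "continuous_on {0..L} f" "0 < L"
  shows "primitive_on L f (weak_deriv L f)"
proof -
  obtain F where F: "primitive_on L F (weak_deriv L f)" "AE x in edge_measure L. f x = F x"
    using weak_deriv_imp_primitive[OF _ weak_deriv_is_weak_deriv[OF assms(1)] assms(3)] assms(1)
    by (auto simp: H1_ivl_def)
  have eq: "f x = F x" if "x \<in> {0..L}" for x
    by (rule continuous_AE_eq_imp_eq[OF assms(2) primitive_on_continuous[OF F(1)] F(2)
        assms(3) that])
  show ?thesis
    unfolding primitive_on_def
  proof (intro conjI ballI)
    show "f x = f 0 + integral {0..x} (weak_deriv L f)" if "x \<in> {0..L}" for x
    proof -
      have "F x = F 0 + integral {0..x} (weak_deriv L f)"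
        using F(1) that unfolding primitive_on_def by blast
      then show ?thesis
        using eq[OF that] eq[of 0] assms(3) by (simp only: atLeastAtMost_iff order.refl less_imp_le)
    qed
  qed (use F(1) in \<open>auto simp: primitive_on_def\<close>)
qed

lemma primitive_H1:
  assumes "primitive_on L f g" "0 < L"
  shows "f \<in> H1_ivl L" and "AE x in edge_measure L. weak_deriv L f x = g x"
proof -
  show H1: "f \<in> H1_ivl L"
    unfolding H1_ivl_def
    using primitive_on_weak_deriv[OF assms] continuous_L2[OF primitive_on_continuous[OF assms(1)]]
    by blast
  show "AE x in edge_measure L. weak_deriv L f x = g x"
    by (rule weak_deriv_unique[OF weak_deriv_is_weak_deriv[OF H1]
        primitive_on_weak_deriv[OF assms]])
qed

lemma primitive_add_scaled:
  assumes "primitive_on L f f'" "primitive_on L g g'"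
  shows "primitive_on L (\<lambda>x. f x + t * g x) (\<lambda>x. f' x + t * g' x)"
  unfolding primitive_on_def
proof (intro conjI ballI)
  have L2: "f' \<in> L2_ivl L" "g' \<in> L2_ivl L"
    by (rule primitive_onD(1)[OF assms(1)], rule primitive_onD(1)[OF assms(2)])
  then show "(\<lambda>x. f' x + t * g' x) \<in> L2_ivl L"
    by (rule L2_add_scaled)
  fix x assume x: "x \<in> {0..L}"
  have "f' integrable_on {0..x}" "g' integrable_on {0..x}"
    using L2 x by (auto intro!: L2_integrable_on(1)[OF L2_integrable])
  then have sum: "integral {0..x} (\<lambda>x. f' x + t * g' x) =
      integral {0..x} f' + t * integral {0..x} g'"
    by (subst integral_add) (auto intro: integrable_on_mult_right)
  then show "f x + t * g x = f 0 + t * g 0 + integral {0..x} (\<lambda>x. f' x + t * g' x)"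
  proof -
    have fx: "f x = f 0 + integral {0..x} f'" and gx: "g x = g 0 + integral {0..x} g'"
      by (rule primitive_onD(2)[OF assms(1) x], rule primitive_onD(2)[OF assms(2) x])
    show ?thesis
      by (subst fx, subst gx, subst sum) (simp add: algebra_simps)
  qed
qed

lemma primitive_on_cong_AE:
  assumes F: "primitive_on L F g" and g': "g' \<in> L2_ivl L"
      and AE: "AE x in edge_measure L. g x = g' x"
  shows "primitive_on L F g'"
  unfolding primitive_on_def
proof (intro conjI ballI g')
  fix x assume x: "x \<in> {0..L}"
  have "AE x in lebesgue. x \<in> {0<..<L} \<longrightarrow> g x = g' x"
    using AE by (subst (asm) AE_restrict_space_iff) auto
  then obtain N where N: "N \<in> null_sets lebesgue" "\<And>x. x \<in> {0<..<L} \<Longrightarrow> x \<notin> N \<Longrightarrow> g x = g' x"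
    unfolding eventually_ae_filter by auto
  have "integral {0..x} g = integral {0..x} g'"
  proof (rule integral_spike)
    show "negligible (N \<union> {0, L})"
      using N(1) by (simp add: negligible_iff_null_sets)
    show "g' t = g t" if "t \<in> {0..x} - (N \<union> {0, L})" for t
      using that x N(2)[of t] by auto
  qed
  then show "F x = F 0 + integral {0..x} g'"
    using primitive_onD(2)[OF F x] by simp
qed

text \<open>The derivative of a function in \<open>H\<^sup>2\<close> has the continuous representative \<open>q\<close>, which is in turn an
  indefinite integral of the second derivative. All later arguments use \<open>q\<close> in place of the
  arbitrary representative chosen by \<open>weak_deriv\<close>.\<close>

lemma H2_primitives:
  assumes "f \<in> H2_ivl L" "continuous_on {0..L} f" "0 < L"
  obtains q where "primitive_on L f q" "primitive_on L q (weak_deriv L (weak_deriv L f))"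
    "AE x in edge_measure L. weak_deriv L f x = q x"
proof -
  have H1: "f \<in> H1_ivl L" "weak_deriv L f \<in> H1_ivl L"
    using assms by (auto simp: H2_ivl_def)
  then have "weak_deriv L f \<in> L2_ivl L"
    by (simp add: H1_ivl_def)
  then obtain q where q: "primitive_on L q (weak_deriv L (weak_deriv L f))"
    "AE x in edge_measure L. weak_deriv L f x = q x"
    using weak_deriv_imp_primitive[OF _ weak_deriv_is_weak_deriv[OF H1(2)] assms(3)] by blast
  have "primitive_on L f q"
    by (rule primitive_on_cong_AE[OF H1_primitive[OF H1(1) assms(2,3)]
          continuous_L2[OF primitive_on_continuous[OF q(1)]] q(2)])
  then show thesis
    using that q by blast
qed

lemma primitive_has_vector_derivative:
  assumes f: "primitive_on L f q" and q: "continuous_on {0..L} q" and x: "x \<in> {0..L}"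
  shows "(f has_vector_derivative q x) (at x within {0..L})"
proof -
  have "((\<lambda>x. f 0 + integral {0..x} q) has_vector_derivative 0 + q x) (at x within {0..L})"
    by (intro has_vector_derivative_add has_vector_derivative_const
        integral_has_vector_derivative[OF q x])
  then have "((\<lambda>x. f 0 + integral {0..x} q) has_vector_derivative q x) (at x within {0..L})"
    by simp
  then show ?thesis
    by (rule has_vector_derivative_transform[OF x primitive_onD(2)[OF f], rotated])
qed

lemma C1_primitive:
  assumes f: "\<And>x. x \<in> {0..L} \<Longrightarrow> (f has_real_derivative f' x) (at x within {0..L})"
    and f': "continuous_on {0..L} f'"
  shows "primitive_on L f f'"
  unfolding primitive_on_def
proof (intro conjI ballI)
  show "f' \<in> L2_ivl L"
    by (rule continuous_L2[OF f'])
  fix x assume x: "x \<in> {0..L}"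
  have "(f' has_integral (f x - f 0)) {0..x}"
  proof (rule fundamental_theorem_of_calculus)
    show "(f has_vector_derivative f' t) (at t within {0..x})" if "t \<in> {0..x}" for t
      using f[of t] that x
      by (auto simp: has_real_derivative_iff_has_vector_derivative[symmetric]
          intro: has_field_derivative_subset)
  qed (use x in auto)
  then show "f x = f 0 + integral {0..x} f'"
    by (simp add: integral_unique)
qed

lemma test_function_primitive:
  assumes "\<eta> \<in> test_functions L"
  shows "primitive_on L \<eta> (deriv \<eta>)"
proof (rule C1_primitive)
  show "(\<eta> has_real_derivative deriv \<eta> x) (at x within {0..L})" for x
    by (rule has_field_derivative_at_within[OF test_functionD(1)[OF assms]])
  show "continuous_on {0..L} (deriv \<eta>)"
    by (rule continuous_on_subset[OF test_functionD(2)[OF assms]]) simp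
qed

lemma zero_primitive: "primitive_on L (\<lambda>x. 0) (\<lambda>x. 0)"
  by (rule C1_primitive) auto

section \<open>Piecewise affine interpolation on an edge\<close>

text \<open>Away from the finitely many grid points, \<open>f\<close> is differentiable, and \<open>g\<close> is the slope of the
  cell that contains the given point. The fundamental theorem of calculus tolerates finitely many
  exceptional points.\<close>

lemma piecewise_affine_primitive:
  fixes f :: "real \<Rightarrow> real"
  assumes L: "0 < L" and N: "1 \<le> N" and cont: "continuous_on {0..L} f"
    and aff: "\<And>i x. i < N \<Longrightarrow> x \<in> {real i * L / real N..real (Suc i) * L / real N} \<Longrightarrow> f x =
        \<alpha> i + \<beta> i * x"
  obtains g where "primitive_on L f g"
    "\<And>i x. i < N \<Longrightarrow> x \<in> {real i * L / real N<..<real (Suc i) * L / real N} \<Longrightarrow> g x = \<beta> i"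
proof -
  define cell where "cell = (\<lambda>x. nat \<lfloor>x * real N / L\<rfloor>)"
  define g where "g = (\<lambda>x. \<beta> (cell x))"
  define S where "S = (\<lambda>i. real i * L / real N) ` {..N}"
  have cellI: "cell x = i" if "x \<in> {real i * L / real N<..<real (Suc i) * L / real N}" for i x
  proof -
    have "real i < x * real N / L" "x * real N / L < real i + 1"
      using that L N by (auto simp: field_simps)
    then have "\<lfloor>x * real N / L\<rfloor> = int i"
      by (simp add: floor_eq_iff)
    then show ?thesis by (simp add: cell_def)
  qed
  have cellE: "cell x < N \<and> x \<in> {real (cell x) * L / real N<..<real (Suc (cell x)) * L / real N}"
    if "x \<in> {0<..<L}" "x \<notin> S" for x
  proof -
    have pos: "0 \<le> x * real N / L" "x * real N / L < real N"
      using that L N by (auto simp: field_simps)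
    have fl: "real (cell x) = of_int \<lfloor>x * real N / L\<rfloor>"
      using pos(1) by (simp add: cell_def)
    then have le: "real (cell x) \<le> x * real N / L" "x * real N / L < real (cell x) + 1"
      by linarith+
    then have lt: "cell x < N" using pos(2) by linarith
    have "x \<noteq> real (cell x) * L / real N"
      using that(2) lt by (auto simp: S_def)
    then show ?thesis
      using lt le L N by (auto simp: field_simps)
  qed
  have deriv: "(f has_vector_derivative g x) (at x)" if x: "x \<in> {0<..<L} - S" for x
  proof -
    let ?i = "cell x"
    have i: "?i < N" "x \<in> {real ?i * L / real N<..<real (Suc ?i) * L / real N}"
      using cellE[of x] x by auto
    have "((\<lambda>x. \<alpha> ?i + \<beta> ?i * x) has_vector_derivative g x) (at x)"
      unfolding has_real_derivative_iff_has_vector_derivative[symmetric] g_def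
      by (auto intro!: derivative_eq_intros)
    then show ?thesis
      by (rule has_vector_derivative_transform_within_open[OF _ open_greaterThanLessThan i(2)])
        (use aff[OF i(1)] in auto)
  qed
  have int: "(g has_integral f x - f 0) {0..x}" if "x \<in> {0..L}" for x
  proof (rule fundamental_theorem_of_calculus_interior_strong)
    show "finite S" by (simp add: S_def)
    show "continuous_on {0..x} f"
      by (rule continuous_on_subset[OF cont]) (use that in auto)
  qed (use that deriv in auto)
  have "g \<in> L2_ivl L"
  proof (rule bounded_measurable_L2)
    have "g integrable_on {0..L}"
      using int[of L] L by (intro has_integral_integrable[of g "f L - f 0"]) simp
    then have "g integrable_on {0<..<L}"
      by (simp add: integrable_on_open_interval_real)
    then show "g \<in> borel_measurable (edge_measure L)"
      by (rule integrable_imp_measurable)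
    show "\<bar>g x\<bar> \<le> (\<Sum>i\<le>N. \<bar>\<beta> i\<bar>)" if x: "x \<in> {0<..<L}" for x
    proof -
      have "x * real N / L \<le> real N" "0 \<le> x * real N / L"
        using x L mult_right_mono[of x L "real N"] by (auto simp: pos_divide_le_eq mult.commute)
      then have "cell x \<le> N"
        unfolding cell_def by linarith
      then show ?thesis
        unfolding g_def by (intro member_le_sum) auto
    qed
  qed
  then have "primitive_on L f g"
    unfolding primitive_on_def using integral_unique[OF int] by auto
  then show thesis
    using cellI by (intro that) (auto simp: g_def)
qed

text \<open>The piecewise affine function with value \<open>u j\<close> at the grid point \<open>j L / N\<close>, written in terms of
  the hat functions of the grid so that its continuity is obvious.\<close>

definition hat_interpolant :: "nat \<Rightarrow> real \<Rightarrow> (nat \<Rightarrow> real) \<Rightarrow> real \<Rightarrow> real" where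
  "hat_interpolant N L u x = (\<Sum>j\<le>N. u j * max 0 (1 - \<bar>x * real N / L - real j\<bar>))"

lemma hat_interpolant_continuous: "continuous_on S (hat_interpolant N L u)"
  unfolding hat_interpolant_def divide_inverse by (intro continuous_intros)

text \<open>Only the hat functions of the two end points of a cell are nonzero on it.\<close>

lemma hat_interpolant_cell:
  assumes L: "0 < L" and i: "i < N"
    and x: "x \<in> {real i * L / real N..real (Suc i) * L / real N}"
  shows "hat_interpolant N L u x = u i + (u (Suc i) - u i) * (x * real N / L - real i)"
proof -
  define t where "t = x * real N / L - real i"
  have t: "0 \<le> t" "t \<le> 1"
    using x L i by (auto simp: t_def field_simps)
  have "hat_interpolant N L u x = (\<Sum>j\<in>{i, Suc i}. u j * max 0 (1 - \<bar>x * real N / L - real j\<bar>))"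
    unfolding hat_interpolant_def
  proof (rule sum.mono_neutral_right)
    show "\<forall>j\<in>{..N} - {i, Suc i}. u j * max 0 (1 - \<bar>x * real N / L - real j\<bar>) = 0"
    proof
      fix j assume "j \<in> {..N} - {i, Suc i}"
      then have "real j \<le> real i - 1 \<or> real i + 2 \<le> real j"
        by auto
      then have "1 \<le> \<bar>x * real N / L - real j\<bar>"
        using t unfolding t_def by linarith
      then show "u j * max 0 (1 - \<bar>x * real N / L - real j\<bar>) = 0"
        by simp
    qed
  qed (use i in auto)
  also have "\<dots> = u i * (1 - t) + u (Suc i) * t"
  proof -
    have "x * real N / L - real i = t" "x * real N / L - real (Suc i) = t - 1"
      by (auto simp: t_def)
    then show ?thesis
      using t by (simp add: max_def)
  qed
  also have "\<dots> = u i + (u (Suc i) - u i) * t"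
    by (simp add: algebra_simps)
  finally show ?thesis
    unfolding t_def .
qed

lemma hat_interpolant_node:
  assumes "0 < L" "1 \<le> N" "i \<le> N"
  shows "hat_interpolant N L u (real i * L / real N) = u i"
proof (cases "i < N")
  case True
  then show ?thesis
    using assms hat_interpolant_cell[OF assms(1) True, of "real i * L / real N" u]
    by (simp add: field_simps)
next
  case False
  then obtain k where k: "i = Suc k" "k < N"
    using assms by (cases i) auto
  then show ?thesis
    using assms hat_interpolant_cell[OF assms(1) k(2), of "real i * L / real N" u]
    by (simp add: field_simps)
qed

lemma L2_square_integrable_on:
  assumes "f \<in> L2_ivl L" "0 \<le> a" "b \<le> L"
  shows "(\<lambda>x. (f x)\<^sup>2) integrable_on {a..b}"
  using assms by (intro L2_integrable_on(1)) (auto simp: L2_ivl_def)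

text \<open>The Cauchy-Schwarz inequality for \<open>\<bar>f\<bar>\<close> and the constant 1, obtained by integrating
  \<open>(\<bar>f\<bar> - m)\<^sup>2 \<ge> 0\<close>, where \<open>m\<close> is the mean value of \<open>\<bar>f\<bar>\<close>.\<close>

lemma integral_abs_squared_le:
  assumes f: "f \<in> L2_ivl L" and ab: "0 \<le> a" "a \<le> b" "b \<le> L"
  shows "(integral {a..b} (\<lambda>x. \<bar>f x\<bar>))\<^sup>2 \<le> (b - a) * integral {a..b} (\<lambda>x. (f x)\<^sup>2)"
proof (cases "a = b")
  case True
  then show ?thesis by simp
next
  case False
  then have pos: "b - a > 0" using ab by simp
  define I where "I = integral {a..b} (\<lambda>x. \<bar>f x\<bar>)"
  define m where "m = I / (b - a)"
  have int: "(\<lambda>x. \<bar>f x\<bar>) integrable_on {a..b}" "(\<lambda>x. (f x)\<^sup>2) integrable_on {a..b}"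
    using L2_integrable_on[OF L2_integrable[OF f] ab(1,3)] L2_square_integrable_on[OF f
        ab(1,3)] by auto
  have "((\<lambda>x. (f x)\<^sup>2 - (2 * m) * \<bar>f x\<bar> + m\<^sup>2) has_integral
      integral {a..b} (\<lambda>x. (f x)\<^sup>2) - (2 * m) * I + (b - a) *\<^sub>R m\<^sup>2) {a..b}"
    unfolding I_def
    by (intro has_integral_add has_integral_diff has_integral_mult_right integrable_integral int
        has_integral_const_real[of "m\<^sup>2" a b, unfolded content_real[OF ab(2)]])
  moreover have "0 \<le> (f x)\<^sup>2 - (2 * m) * \<bar>f x\<bar> + m\<^sup>2" for x
    using zero_le_power2[of "\<bar>f x\<bar> - m"] by (simp add: power2_diff algebra_simps)
  ultimately have "0 \<le> integral {a..b} (\<lambda>x. (f x)\<^sup>2) - (2 * m) * I + (b - a) *\<^sub>R m\<^sup>2"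
    by (rule has_integral_nonneg)
  also have "(b - a) *\<^sub>R m\<^sup>2 = m * I"
    using pos by (simp add: m_def power2_eq_square)
  finally have "m * I \<le> integral {a..b} (\<lambda>x. (f x)\<^sup>2)"
    by (simp add: mult.commute)
  then have "(b - a) * (m * I) \<le> (b - a) * integral {a..b} (\<lambda>x. (f x)\<^sup>2)"
    using pos by simp
  moreover have "(b - a) * (m * I) = I\<^sup>2"
    using pos by (simp add: m_def power2_eq_square)
  ultimately show ?thesis
    by (simp add: I_def)
qed

lemma primitive_increment:
  assumes F: "primitive_on L F g" and x: "x \<in> {0..L}" "y \<in> {0..L}" "x \<le> y"
  shows "F y - F x = integral {x..y} g"
  using Henstock_Kurzweil_Integration.integral_combine[of 0 x y g]
    L2_integrable_on(1)[OF L2_integrable[OF primitive_onD(1)[OF F]], of 0 y]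
    primitive_onD(2)[OF F x(1)] primitive_onD(2)[OF F x(2)] x by simp

lemma primitive_oscillation:
  assumes F: "primitive_on L F g" and ab: "0 \<le> a" "b \<le> L" and x: "x \<in> {a..b}" "y \<in> {a..b}"
  shows "\<bar>F y - F x\<bar> \<le> integral {a..b} (\<lambda>x. \<bar>g x\<bar>)"
proof -
  have *: "\<bar>F y - F x\<bar> \<le> integral {a..b} (\<lambda>x. \<bar>g x\<bar>)" if "x \<in> {a..b}" "y \<in> {a..b}" "x \<le> y" for x y
  proof -
    note int = L2_integrable_on[OF L2_integrable[OF primitive_onD(1)[OF F]]]
    have "\<bar>F y - F x\<bar> = \<bar>integral {x..y} g\<bar>"
      using primitive_increment[OF F] that ab by auto
    also have "\<dots> \<le> integral {x..y} (\<lambda>x. \<bar>g x\<bar>)"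
      using integral_norm_bound_integral[of g "{x..y}" "\<lambda>x. \<bar>g x\<bar>"] int[of x y] that ab by auto
    also have "\<dots> \<le> integral {a..b} (\<lambda>x. \<bar>g x\<bar>)"
      using int[of x y] int[of a b] that ab by (intro integral_subset_le) auto
    finally show ?thesis .
  qed
  show ?thesis
    using *[of x y] *[of y x] x by (cases "x \<le> y") (auto simp: abs_minus_commute)
qed

lemma Poincare:
  assumes F: "primitive_on L F g" and L: "0 < L" and F0: "F 0 = 0"
  shows "(LINT x|edge_measure L. (F x)\<^sup>2) \<le> L\<^sup>2 * (LINT x|edge_measure L. (g x)\<^sup>2)"
proof -
  define E where "E = (LINT x|edge_measure L. (g x)\<^sup>2)"
  have g: "g \<in> L2_ivl L" and FL2: "F \<in> L2_ivl L"
    using primitive_onD(1)[OF F] continuous_L2[OF primitive_on_continuous[OF F]] by auto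
  have E: "E = integral {0..L} (\<lambda>x. (g x)\<^sup>2)"
    unfolding E_def using g by (intro LINT_edge) (simp add: L2_ivl_def)
  have bound: "(F x)\<^sup>2 \<le> L * E" if "x \<in> {0..L}" for x
  proof -
    have "\<bar>F x\<bar> \<le> integral {0..L} (\<lambda>x. \<bar>g x\<bar>)"
      using primitive_oscillation[OF F, of 0 L 0 x] that L F0 by auto
    then have "(F x)\<^sup>2 \<le> (integral {0..L} (\<lambda>x. \<bar>g x\<bar>))\<^sup>2"
      by (metis abs_ge_zero power2_abs power_mono)
    also have "\<dots> \<le> L * E"
      using integral_abs_squared_le[OF g, of 0 L] L E by simp
    finally show ?thesis .
  qed
  have "integral {0..L} (\<lambda>x. (F x)\<^sup>2) \<le> integral {0..L} (\<lambda>x. L * E)"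
    by (intro integral_le L2_square_integrable_on[OF FL2] bound) auto
  then show ?thesis
    using FL2 L unfolding E_def[symmetric]
    by (subst LINT_edge) (auto simp: L2_ivl_def power2_eq_square algebra_simps)
qed

text \<open>On each cell the slope of the interpolant is a value \<open>q \<xi>\<close> of \<open>q = f'\<close>, by the mean value
  theorem. So the derivative of the error is \<open>q x - q \<xi>\<close> there, which is bounded by the integral of
  \<open>\<bar>r\<bar>\<close> over the cell. By the Cauchy-Schwarz inequality its square is at most \<open>\<delta>\<close> times the
  integral of \<open>r\<^sup>2\<close> over the cell; integrating over the cell gives a second factor \<open>\<delta>\<close>.\<close>

lemma interpolation_error:
  assumes L: "0 < L" and N: "1 \<le> N" and f: "primitive_on L f q" and q: "primitive_on L q r"
  obtains d' where
    "primitive_on L (\<lambda>x. f x - hat_interpolant N L (\<lambda>i. f (real i * L / real N)) x) d'"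
    "(LINT x|edge_measure L. (d' x)\<^sup>2) \<le> (L / real N)\<^sup>2 * (LINT x|edge_measure L. (r x)\<^sup>2)"
proof -
  define \<delta> where "\<delta> = L / real N"
  define X where "X = (\<lambda>i. real i * L / real N)"
  define I where "I = hat_interpolant N L (\<lambda>i. f (X i))"
  define \<beta> where "\<beta> = (\<lambda>i. (f (X (Suc i)) - f (X i)) / \<delta>)"
  define \<alpha> where "\<alpha> = (\<lambda>i. f (X i) - (f (X (Suc i)) - f (X i)) * real i)"
  have \<delta>: "0 < \<delta>" using L N by (simp add: \<delta>_def)
  have X: "0 \<le> X i" "X (Suc i) = X i + \<delta>" for i
    using L N by (auto simp: X_def \<delta>_def field_simps)
  have XN: "X N = L" "X 0 = 0" using N by (auto simp: X_def)
  have X_le: "X i \<le> L" if "i \<le> N" for i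
    using that L N by (simp add: X_def field_simps)
  have aff: "I x = \<alpha> i + \<beta> i * x" if "i < N" "x \<in> {X i..X (Suc i)}" for i x
    using hat_interpolant_cell[OF L that(1) that(2)[unfolded X_def], of "\<lambda>i. f (X i)"] L N
    unfolding I_def[symmetric] \<alpha>_def \<beta>_def \<delta>_def by (simp add: field_simps)
  obtain g where g: "primitive_on L I g"
    and g_cell: "\<And>i x. i < N \<Longrightarrow> x \<in> {X i<..<X (Suc i)} \<Longrightarrow> g x = \<beta> i"
    using piecewise_affine_primitive[OF L N, of I \<alpha> \<beta>] aff hat_interpolant_continuous
    unfolding X_def I_def by blast
  define d' where "d' = (\<lambda>x. q x + (-1) * g x)"
  have d: "primitive_on L (\<lambda>x. f x - I x) d'"
    using primitive_add_scaled[OF f g, of "-1"] by (simp add: d'_def)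
  have d'_L2: "d' \<in> L2_ivl L" and r_L2: "r \<in> L2_ivl L"
    using primitive_onD(1)[OF d] primitive_onD(1)[OF q] .
  have q_cont: "continuous_on {0..L} q"
    by (rule primitive_on_continuous[OF q])
  have cell: "integral {X i..X (Suc i)} (\<lambda>x. (d' x)\<^sup>2) \<le>
      \<delta>\<^sup>2 * integral {X i..X (Suc i)} (\<lambda>x. (r x)\<^sup>2)"
    if i: "i < N" for i
  proof -
    let ?J = "{X i..X (Suc i)}"
    have le: "0 \<le> X i" "X i < X (Suc i)" "X (Suc i) \<le> L"
      using X[of i] \<delta> X_le[of "Suc i"] i by auto
    define R where "R = integral ?J (\<lambda>x. \<bar>r x\<bar>)"
    obtain \<xi> where \<xi>: "\<xi> \<in> {X i<..<X (Suc i)}" "f (X (Suc i)) - f (X i) = (X (Suc i) - X i) * q \<xi>"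
    proof -
      have "\<exists>\<xi>\<in>{X i<..<X (Suc i)}. f (X (Suc i)) - f (X i) = (\<lambda>h. h * q \<xi>) (X (Suc i) - X i)"
      proof (rule mvt[OF le(2)])
        show "continuous_on ?J f"
          by (rule continuous_on_subset[OF primitive_on_continuous[OF f]]) (use le in auto)
        fix x assume x: "X i < x" "x < X (Suc i)"
        have "(f has_vector_derivative q x) (at x within {0..L})"
          by (rule primitive_has_vector_derivative[OF f q_cont]) (use x le in auto)
        moreover have "at x within {0..L} = at x"
          by (rule at_within_interior) (use x le in auto)
        ultimately show "(f has_derivative (\<lambda>h. h * q x)) (at x)"
          by (simp add: has_vector_derivative_def)
      qed auto
      then show thesis using that by blast
    qed
    have \<beta>: "\<beta> i = q \<xi>"
      using \<xi>(2) X(2)[of i] \<delta> by (simp add: \<beta>_def)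
    have R: "R\<^sup>2 \<le> \<delta> * integral ?J (\<lambda>x. (r x)\<^sup>2)"
      using integral_abs_squared_le[OF r_L2 le(1) less_imp_le[OF le(2)] le(3)] X(2)[of i]
      by (simp add: R_def)
    have "integral ?J (\<lambda>x. (d' x)\<^sup>2) = integral {X i<..<X (Suc i)} (\<lambda>x. (d' x)\<^sup>2)"
      by (simp add: integral_open_interval_real)
    also have "\<dots> \<le> integral {X i<..<X (Suc i)} (\<lambda>x. R\<^sup>2)"
    proof (rule integral_le)
      show "(\<lambda>x. (d' x)\<^sup>2) integrable_on {X i<..<X (Suc i)}"
        using L2_square_integrable_on[OF d'_L2 le(1,3)]
          by (simp add: integrable_on_open_interval_real)
      show "(\<lambda>x. R\<^sup>2) integrable_on {X i<..<X (Suc i)}"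
        unfolding integrable_on_open_interval_real
        by (rule integrable_continuous_interval[OF continuous_on_const])
      fix x assume x: "x \<in> {X i<..<X (Suc i)}"
      have "d' x = q x - q \<xi>"
        using g_cell[OF i x] \<beta> by (simp add: d'_def)
      moreover have "\<bar>q x - q \<xi>\<bar> \<le> R"
        unfolding R_def by (rule primitive_oscillation[OF q]) (use le x \<xi>(1) in auto)
      ultimately show "(d' x)\<^sup>2 \<le> R\<^sup>2"
        by (metis abs_ge_zero power2_abs power_mono)
    qed
    also have "\<dots> = \<delta> * R\<^sup>2"
      unfolding integral_open_interval_real[symmetric] using X(2)[of i] \<delta> by simp
    also have "\<dots> \<le> \<delta> * (\<delta> * integral ?J (\<lambda>x. (r x)\<^sup>2))"
      using R \<delta> by (intro mult_left_mono) auto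
    finally show ?thesis
      by (simp add: power2_eq_square)
  qed
  have "integral {0..X i} (\<lambda>x. (d' x)\<^sup>2) \<le> \<delta>\<^sup>2 * integral {0..X i} (\<lambda>x. (r x)\<^sup>2)" if "i \<le> N" for i
    using that
  proof (induction i)
    case 0
    then show ?case by (simp add: XN)
  next
    case (Suc i)
    have le: "0 \<le> X i" "X i \<le> X (Suc i)" "X (Suc i) \<le> L"
      using X[of i] \<delta> X_le[of "Suc i"] Suc.prems by auto
    have split: "integral {0..X i} (\<lambda>x. (h x)\<^sup>2) + integral {X i..X (Suc i)} (\<lambda>x. (h x)\<^sup>2) =
        integral {0..X (Suc i)} (\<lambda>x. (h x)\<^sup>2)" if "h \<in> L2_ivl L" for h
      by (rule Henstock_Kurzweil_Integration.integral_combine[OF le(1,2)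
            L2_square_integrable_on[OF that order_refl le(3)]])
    show ?case
      unfolding split[OF d'_L2, symmetric] split[OF r_L2, symmetric] distrib_left
      using Suc cell[of i] by (intro add_mono) auto
  qed
  from this[OF order_refl] have "(LINT x|edge_measure L. (d' x)\<^sup>2) \<le>
      \<delta>\<^sup>2 * (LINT x|edge_measure L. (r x)\<^sup>2)"
    using d'_L2 r_L2 unfolding XN by (subst (1 2) LINT_edge) (auto simp: L2_ivl_def)
  with d show thesis
    using that unfolding I_def X_def \<delta>_def by blast
qed

text \<open>The interpolation error vanishes at 0, so by Poincare's inequality the term of order zero is
  controlled by the derivative. The assumption that defines \<open>d\<close> only serves to abbreviate the
  interpolation error.\<close>

lemma interpolation_energy_error:
  assumes c: "c \<in> Linf_ivl L" and L: "0 < L"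
  obtains K where "0 \<le> K" "\<And>N f q r d. 1 \<le> N \<Longrightarrow> primitive_on L f q \<Longrightarrow> primitive_on L q r \<Longrightarrow>
    d = (\<lambda>x. f x - hat_interpolant N L (\<lambda>i. f (real i * L / real N)) x) \<Longrightarrow>
    \<exists>d'. primitive_on L d d' \<and>
      (LINT x|edge_measure L. d' x * d' x + c x * d x * d x) \<le>
        K * (L / real N)\<^sup>2 * (LINT x|edge_measure L. (r x)\<^sup>2)"
proof -
  obtain C where C: "AE x in edge_measure L. \<bar>c x\<bar> \<le> C"
    using c by (auto simp: Linf_ivl_def)
  define K where "K = 1 + \<bar>C\<bar> * L\<^sup>2"
  have "\<exists>d'. primitive_on L d d' \<and>
      (LINT x|edge_measure L. d' x * d' x + c x * d x * d x) \<le>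
        K * (L / real N)\<^sup>2 * (LINT x|edge_measure L. (r x)\<^sup>2)"
    if N: "1 \<le> N" and f: "primitive_on L f q" and q: "primitive_on L q r"
      and d_def: "d = (\<lambda>x. f x - hat_interpolant N L (\<lambda>i. f (real i * L / real N)) x)" for N f q r d
  proof -
    obtain d' where d: "primitive_on L d d'"
      and est: "(LINT x|edge_measure L. (d' x)\<^sup>2) \<le>
        (L / real N)\<^sup>2 * (LINT x|edge_measure L. (r x)\<^sup>2)"
      using interpolation_error[OF L N f q] unfolding d_def by blast
    have d0: "d 0 = 0"
      using hat_interpolant_node[OF L N, of 0 "\<lambda>i. f (real i * L / real N)"] by (simp add: d_def)
    have d_L2: "d \<in> L2_ivl L" and d'_L2: "d' \<in> L2_ivl L"
      using continuous_L2[OF primitive_on_continuous[OF d]] primitive_onD(1)[OF d] .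
    have int: "integrable (edge_measure L) (\<lambda>x. d' x * d' x + c x * d x * d x)"
      using L2_mult_integrable[OF d'_L2 d'_L2] L2_mult_integrable[OF Linf_mult_L2[OF c d_L2] d_L2]
      by simp
    have int2: "integrable (edge_measure L) (\<lambda>x. (d' x)\<^sup>2)" "integrable (edge_measure L) (\<lambda>x.
        (d x)\<^sup>2)"
      using d_L2 d'_L2 by (auto simp: L2_ivl_def)
    have "(LINT x|edge_measure L. d' x * d' x + c x * d x * d x) \<le>
        (LINT x|edge_measure L. (d' x)\<^sup>2 + \<bar>C\<bar> * (d x)\<^sup>2)"
    proof (rule integral_mono_AE[OF int])
      show "integrable (edge_measure L) (\<lambda>x. (d' x)\<^sup>2 + \<bar>C\<bar> * (d x)\<^sup>2)"
        using int2 by simp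
      show "AE x in edge_measure L. d' x * d' x + c x * d x * d x \<le> (d' x)\<^sup>2 + \<bar>C\<bar> * (d x)\<^sup>2"
        using C
      proof eventually_elim
        case (elim x)
        then have "c x \<le> \<bar>C\<bar>" by linarith
        then have "c x * (d x)\<^sup>2 \<le> \<bar>C\<bar> * (d x)\<^sup>2"
          by (rule mult_right_mono) simp
        then show ?case
          by (simp add: power2_eq_square mult.assoc)
      qed
    qed
    also have "\<dots> = (LINT x|edge_measure L. (d' x)\<^sup>2) + \<bar>C\<bar> * (LINT x|edge_measure L. (d x)\<^sup>2)"
      using int2 by simp
    also have "\<dots> \<le> (LINT x|edge_measure L. (d' x)\<^sup>2)
        + \<bar>C\<bar> * (L\<^sup>2 * (LINT x|edge_measure L. (d' x)\<^sup>2))"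
      by (intro add_left_mono mult_left_mono Poincare[OF d L d0]) simp
    also have "\<dots> = K * (LINT x|edge_measure L. (d' x)\<^sup>2)"
      by (simp add: K_def algebra_simps)
    also have "\<dots> \<le> K * ((L / real N)\<^sup>2 * (LINT x|edge_measure L. (r x)\<^sup>2))"
      by (intro mult_left_mono est) (simp add: K_def)
    finally show ?thesis
      using d by (auto simp: mult.assoc)
  qed
  then show thesis
    by (intro that[of K]) (auto simp: K_def)
qed

section \<open>Linear structure of the function spaces on the graph\<close>

lemma has_vertex_value_add_scaled:
  assumes "has_vertex_value \<Gamma> f v a" "has_vertex_value \<Gamma> g v b"
  shows "has_vertex_value \<Gamma> (\<lambda>e x. f e x + t * g e x) v (a + t * b)"
  using assms by (auto simp: has_vertex_value_def)

lemma continuous_graph_fun_add_scaled: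
  assumes "continuous_graph_fun \<Gamma> f" "continuous_graph_fun \<Gamma> g"
  shows "continuous_graph_fun \<Gamma> (\<lambda>e x. f e x + t * g e x)"
  unfolding continuous_graph_fun_def
proof (intro conjI ballI)
  show "continuous_on {0..len \<Gamma> e} (\<lambda>x. f e x + t * g e x)" if "e \<in> edges \<Gamma>" for e
    using assms that by (intro continuous_intros) (auto simp: continuous_graph_fun_def)
  fix v assume "v \<in> verts \<Gamma>"
  then obtain a b where "has_vertex_value \<Gamma> f v a" "has_vertex_value \<Gamma> g v b"
    using assms unfolding continuous_graph_fun_def by blast
  then show "\<exists>c. has_vertex_value \<Gamma> (\<lambda>e x. f e x + t * g e x) v c"
    using has_vertex_value_add_scaled[of \<Gamma> f v a g b t] by blast
qed

lemma Vh_add_scaled: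
  assumes "f \<in> Vh \<Gamma> n" "g \<in> Vh \<Gamma> n"
  shows "(\<lambda>e x. f e x + t * g e x) \<in> Vh \<Gamma> n"
  unfolding Vh_def
proof (intro CollectI conjI ballI allI impI)
  show "continuous_graph_fun \<Gamma> (\<lambda>e x. f e x + t * g e x)"
    using assms by (intro continuous_graph_fun_add_scaled) (auto simp: Vh_def)
  fix e i assume e: "e \<in> edges \<Gamma>" and i: "i < n e"
  let ?I = "{grid_point \<Gamma> n e i..grid_point \<Gamma> n e (Suc i)}"
  obtain \<alpha> \<beta> \<alpha>' \<beta>' where "\<forall>x\<in>?I. f e x = \<alpha> + \<beta> * x" "\<forall>x\<in>?I. g e x = \<alpha>' + \<beta>' * x"
    using assms e i unfolding Vh_def by blast
  then have "\<forall>x\<in>?I. f e x + t * g e x = (\<alpha> + t * \<alpha>') + (\<beta> + t * \<beta>') * x"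
    by (simp add: algebra_simps)
  then show "\<exists>\<alpha> \<beta>. \<forall>x\<in>?I. f e x + t * g e x = \<alpha> + \<beta> * x"
    by blast
qed

definition graph_hat_interpolant ::
  "('v, 'e) metric_graph \<Rightarrow> ('e \<Rightarrow> nat) \<Rightarrow> ('e \<Rightarrow> nat \<Rightarrow> real) \<Rightarrow> 'e graph_fun" where
  "graph_hat_interpolant \<Gamma> n u = (\<lambda>e. hat_interpolant (n e) (len \<Gamma> e) (u e))"

text \<open>On a loop at \<open>v\<close> both summands are present, and the function is constantly 1.\<close>

definition edge_hat :: "('v, 'e) metric_graph \<Rightarrow> 'v \<Rightarrow> 'e graph_fun" where
  "edge_hat \<Gamma> v = (\<lambda>e x. (if tail \<Gamma> e = v then 1 - x / len \<Gamma> e else 0) +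
                        (if head \<Gamma> e = v then x / len \<Gamma> e else 0))"

lemma edge_hat_affine: 
  "edge_hat \<Gamma> v e x = edge_hat \<Gamma> v e 0 + (edge_hat \<Gamma> v e 1 - edge_hat \<Gamma> v e 0) * x"
  by (simp add: edge_hat_def)

section \<open>The energy form\<close>

locale graph_problem =
  fixes \<Gamma> :: "('v, 'e) metric_graph" and VD :: "'v set" and c0 :: "'e graph_fun"
  assumes graph: "is_metric_graph \<Gamma>"
    and VD: "VD \<subseteq> verts \<Gamma>"
    and c0: "c0 \<in> Linf_graph \<Gamma>"
    and c0_nonneg: "\<forall>e\<in>edges \<Gamma>. AE x in edge_measure (len \<Gamma> e). c0 e x \<ge> 0"
begin

lemma finite_edges [simp]: "finite (edges \<Gamma>)"
  using graph by (simp add: is_metric_graph_def)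

lemma len_pos [simp]: "e \<in> edges \<Gamma> \<Longrightarrow> 0 < len \<Gamma> e"
  using graph by (simp add: is_metric_graph_def)

lemma c0_edge: "e \<in> edges \<Gamma> \<Longrightarrow> c0 e \<in> Linf_ivl (len \<Gamma> e)"
  using c0 by (simp add: Linf_graph_def)

lemma H1_edge_continuous:
  assumes "f \<in> H1_graph \<Gamma>" "e \<in> edges \<Gamma>"
  shows "continuous_on {0..len \<Gamma> e} (f e)"
  using assms by (auto simp: H1_graph_def continuous_graph_fun_def)

lemma H1_edge_primitive:
  assumes "f \<in> H1_graph \<Gamma>" "e \<in> edges \<Gamma>"
  shows "primitive_on (len \<Gamma> e) (f e) (graph_deriv \<Gamma> f e)"
  by (rule H1_primitive[OF _ H1_edge_continuous[OF assms] len_pos[OF assms(2)]])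
    (use assms in \<open>auto simp: H1_graph_def\<close>)

lemma H1_graphI:
  assumes "continuous_graph_fun \<Gamma> f" "\<And>e. e \<in> edges \<Gamma> \<Longrightarrow> primitive_on (len \<Gamma> e) (f e) (f' e)"
  shows "f \<in> H1_graph \<Gamma>"
  using assms primitive_H1(1) len_pos unfolding H1_graph_def by blast

lemma H1_graph_add_scaled:
  assumes "f \<in> H1_graph \<Gamma>" "g \<in> H1_graph \<Gamma>"
  shows "(\<lambda>e x. f e x + t * g e x) \<in> H1_graph \<Gamma>"
proof (rule H1_graphI)
  show "continuous_graph_fun \<Gamma> (\<lambda>e x. f e x + t * g e x)"
    using assms by (intro continuous_graph_fun_add_scaled) (auto simp: H1_graph_def)
  show "primitive_on (len \<Gamma> e) (\<lambda>x. f e x + t * g e x)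
      (\<lambda>x. graph_deriv \<Gamma> f e x + t * graph_deriv \<Gamma> g e x)" if "e \<in> edges \<Gamma>" for e
    by (intro primitive_add_scaled H1_edge_primitive assms that)
qed

lemma H1_graph_diff:
  assumes "f \<in> H1_graph \<Gamma>" "g \<in> H1_graph \<Gamma>"
  shows "(\<lambda>e x. f e x - g e x) \<in> H1_graph \<Gamma>"
  using H1_graph_add_scaled[OF assms, of "-1"] by simp

lemma H1D_graph_diff:
  assumes "f \<in> H1D_graph \<Gamma> VD" "g \<in> H1D_graph \<Gamma> VD"
  shows "(\<lambda>e x. f e x - g e x) \<in> H1D_graph \<Gamma> VD"
  using assms H1_graph_diff[of f g] has_vertex_value_add_scaled[of \<Gamma> f _ 0 g 0 "-1"]
  by (auto simp: H1D_graph_def)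

lemma VhD_diff:
  assumes "f \<in> VhD \<Gamma> VD n" "g \<in> VhD \<Gamma> VD n"
  shows "(\<lambda>e x. f e x - g e x) \<in> VhD \<Gamma> VD n"
  using assms H1D_graph_diff[of f g] Vh_add_scaled[of f \<Gamma> n g "-1"] by (auto simp: VhD_def)

lemma energy_integrable:
  assumes e: "e \<in> edges \<Gamma>" and "primitive_on (len \<Gamma> e) f f'" "primitive_on (len \<Gamma> e) g g'"
  shows "integrable (edge_measure (len \<Gamma> e)) (\<lambda>x. f' x * g' x)"
    and "integrable (edge_measure (len \<Gamma> e)) (\<lambda>x. c0 e x * f x * g x)"
    and "integrable (edge_measure (len \<Gamma> e)) (\<lambda>x. f' x * g' x + c0 e x * f x * g x)"
proof -
  have L2: "f' \<in> L2_ivl (len \<Gamma> e)" "g' \<in> L2_ivl (len \<Gamma> e)" "f \<in> L2_ivl (len \<Gamma> e)" "g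
      \<in> L2_ivl (len \<Gamma> e)"
    using assms(2,3)[THEN primitive_onD(1)] assms(2,3)[THEN primitive_on_continuous, THEN
        continuous_L2]
    by auto
  show "integrable (edge_measure (len \<Gamma> e)) (\<lambda>x. f' x * g' x)"
    by (rule L2_mult_integrable[OF L2(1,2)])
  moreover show "integrable (edge_measure (len \<Gamma> e)) (\<lambda>x. c0 e x * f x * g x)"
    by (rule L2_mult_integrable[OF Linf_mult_L2[OF c0_edge[OF e] L2(3)] L2(4)])
  ultimately show "integrable (edge_measure (len \<Gamma> e)) (\<lambda>x. f' x * g' x + c0 e x * f x * g x)"
    by (rule Bochner_Integration.integrable_add)
qed

text \<open>The energy form can be computed with any derivatives, since they agree with the chosen weak
  derivatives almost everywhere. This is how linearity and all concrete evaluations of the form are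
  obtained.\<close>

lemma bilin_primitives:
  assumes f: "\<And>e. e \<in> edges \<Gamma> \<Longrightarrow> primitive_on (len \<Gamma> e) (f e) (f' e)"
    and g: "\<And>e. e \<in> edges \<Gamma> \<Longrightarrow> primitive_on (len \<Gamma> e) (g e) (g' e)"
  shows "bilin \<Gamma> c0 f g =
      (\<Sum>e\<in>edges \<Gamma>. LINT x|edge_measure (len \<Gamma> e). f' e x * g' e x + c0 e x * f e x * g e x)"
  unfolding bilin_def
proof (rule sum.cong[OF refl])
  fix e assume e: "e \<in> edges \<Gamma>"
  have H1: "primitive_on (len \<Gamma> e) \<phi> (weak_deriv (len \<Gamma> e) \<phi>)"
      if "primitive_on (len \<Gamma> e) \<phi> \<psi>" for \<phi> \<psi>
    by (rule H1_primitive[OF primitive_H1(1)[OF that len_pos[OF e]] primitive_on_continuous[OF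
        that] len_pos[OF e]])
  show "(LINT x|edge_measure (len \<Gamma> e). graph_deriv \<Gamma> f e x * graph_deriv \<Gamma> g e x
      + c0 e x * f e x * g e x) =
      (LINT x|edge_measure (len \<Gamma> e). f' e x * g' e x + c0 e x * f e x * g e x)"
  proof (rule integral_cong_AE)
    show "(\<lambda>x. graph_deriv \<Gamma> f e x * graph_deriv \<Gamma> g e x + c0 e x * f e x * g e x)
        \<in> borel_measurable (edge_measure (len \<Gamma> e))"
      by (rule borel_measurable_integrable[OF energy_integrable(3)[OF e H1[OF f[OF e]] H1[OF
        g[OF e]]]])
    show "(\<lambda>x. f' e x * g' e x + c0 e x * f e x * g e x)
        \<in> borel_measurable (edge_measure (len \<Gamma> e))"
      by (rule borel_measurable_integrable[OF energy_integrable(3)[OF e f[OF e] g[OF e]]])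
    show "AE x in edge_measure (len \<Gamma> e). graph_deriv \<Gamma> f e x * graph_deriv \<Gamma> g e x
        + c0 e x * f e x * g e x =
        f' e x * g' e x + c0 e x * f e x * g e x"
      using primitive_H1(2)[OF f[OF e] len_pos[OF e]] primitive_H1(2)[OF g[OF e] len_pos[OF e]]
      by eventually_elim simp
  qed
qed

lemma bilin_commute: "bilin \<Gamma> c0 f g = bilin \<Gamma> c0 g f"
  by (simp add: bilin_def mult.commute mult.left_commute)

lemma bilin_add_scaled_right:
  assumes f: "f \<in> H1_graph \<Gamma>" and g: "g \<in> H1_graph \<Gamma>" and h: "h \<in> H1_graph \<Gamma>"
  shows "bilin \<Gamma> c0 h (\<lambda>e x. f e x + t * g e x) = bilin \<Gamma> c0 h f + t * bilin \<Gamma> c0 h g"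
proof -
  have "bilin \<Gamma> c0 h (\<lambda>e x. f e x + t * g e x) =
      (\<Sum>e\<in>edges \<Gamma>. LINT x|edge_measure (len \<Gamma> e). graph_deriv \<Gamma> h e x * (graph_deriv \<Gamma> f e x
        + t * graph_deriv \<Gamma> g e x)
         + c0 e x * h e x * (f e x + t * g e x))"
    by (rule bilin_primitives) (intro H1_edge_primitive primitive_add_scaled assms; assumption)+
  also have "\<dots> = (\<Sum>e\<in>edges \<Gamma>. (LINT x|edge_measure (len \<Gamma> e). graph_deriv \<Gamma> h e x * graph_deriv \<Gamma>
      f e x + c0 e x * h e x * f e x)
       + t * (LINT x|edge_measure (len \<Gamma> e). graph_deriv \<Gamma> h e x * graph_deriv \<Gamma> g e x
         + c0 e x * h e x * g e x))"
  proof (rule sum.cong[OF refl])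
    fix e assume e: "e \<in> edges \<Gamma>"
    note int = energy_integrable(3)[OF e H1_edge_primitive[OF h e] H1_edge_primitive[OF f e]]
      energy_integrable(3)[OF e H1_edge_primitive[OF h e] H1_edge_primitive[OF g e]]
    have "(\<lambda>x. graph_deriv \<Gamma> h e x * (graph_deriv \<Gamma> f e x + t * graph_deriv \<Gamma> g e x)
         + c0 e x * h e x * (f e x + t * g e x)) =
       (\<lambda>x. (graph_deriv \<Gamma> h e x * graph_deriv \<Gamma> f e x + c0 e x * h e x * f e x)
         + t * (graph_deriv \<Gamma> h e x * graph_deriv \<Gamma> g e x + c0 e x * h e x * g e x))"
      by (auto simp: algebra_simps)
    then show "(LINT x|edge_measure (len \<Gamma> e). graph_deriv \<Gamma> h e x * (graph_deriv \<Gamma> f e x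
        + t * graph_deriv \<Gamma> g e x)
         + c0 e x * h e x * (f e x + t * g e x)) = 
      (LINT x|edge_measure (len \<Gamma> e). graph_deriv \<Gamma> h e x * graph_deriv \<Gamma> f e x
        + c0 e x * h e x * f e x)
       + t * (LINT x|edge_measure (len \<Gamma> e). graph_deriv \<Gamma> h e x * graph_deriv \<Gamma> g e x
         + c0 e x * h e x * g e x)"
      using int by (simp only: Bochner_Integration.integral_add integral_mult_right_zero
        integrable_mult_right)
  qed
  also have "\<dots> = bilin \<Gamma> c0 h f + t * bilin \<Gamma> c0 h g"
    by (simp add: bilin_def sum.distrib sum_distrib_left)
  finally show ?thesis .
qed

lemma bilin_diff_right:
  assumes "f \<in> H1_graph \<Gamma>" "g \<in> H1_graph \<Gamma>" "h \<in> H1_graph \<Gamma>"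
  shows "bilin \<Gamma> c0 h (\<lambda>e x. f e x - g e x) = bilin \<Gamma> c0 h f - bilin \<Gamma> c0 h g"
  using bilin_add_scaled_right[OF assms, of "-1"] by simp

lemma bilin_nonneg:
  assumes "f \<in> H1_graph \<Gamma>"
  shows "0 \<le> bilin \<Gamma> c0 f f"
  unfolding bilin_def
proof (intro sum_nonneg integral_nonneg_AE)
  fix e assume "e \<in> edges \<Gamma>"
  then have "AE x in edge_measure (len \<Gamma> e). c0 e x \<ge> 0"
    using c0_nonneg by blast
  then show "AE x in edge_measure (len \<Gamma> e). 0 \<le>
      graph_deriv \<Gamma> f e x * graph_deriv \<Gamma> f e x + c0 e x * f e x * f e x"
    by eventually_elim (simp add: mult.assoc)
qed

lemma bilin_square_expand:
  assumes "f \<in> H1_graph \<Gamma>" "g \<in> H1_graph \<Gamma>"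
  shows "bilin \<Gamma> c0 (\<lambda>e x. f e x + t * g e x) (\<lambda>e x. f e x + t * g e x) =
    bilin \<Gamma> c0 f f + 2 * t * bilin \<Gamma> c0 f g + t\<^sup>2 * bilin \<Gamma> c0 g g"
proof -
  let ?h = "\<lambda>e x. f e x + t * g e x"
  have "bilin \<Gamma> c0 ?h ?h = bilin \<Gamma> c0 ?h f + t * bilin \<Gamma> c0 ?h g"
    by (rule bilin_add_scaled_right[OF assms H1_graph_add_scaled[OF assms]])
  also have "\<dots> = bilin \<Gamma> c0 f ?h + t * bilin \<Gamma> c0 g ?h"
    by (simp only: bilin_commute[of ?h])
  also have "\<dots> = (bilin \<Gamma> c0 f f + t * bilin \<Gamma> c0 f g) + t * (bilin \<Gamma> c0 g f + t * bilin \<Gamma> c0 g g)"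
    using assms by (simp only: bilin_add_scaled_right)
  also have "bilin \<Gamma> c0 g f = bilin \<Gamma> c0 f g"
    by (rule bilin_commute)
  finally show ?thesis
    by (simp add: power2_eq_square algebra_simps)
qed

lemma quadratic_nonneg_discriminant:
  fixes a b c :: real
  assumes "\<And>t. 0 \<le> c + 2 * t * b + t\<^sup>2 * a" and "0 \<le> a"
  shows "b\<^sup>2 \<le> a * c"
proof (cases "a = 0")
  case True
  have "b = 0"
  proof (rule ccontr)
    assume "b \<noteq> 0"
    then show False
      \<comment> \<open>A linear function of \<open>t\<close>; this \<open>t\<close> makes its value \<open>-1\<close>.\<close>
      using assms(1)[of "- (c + 1) / (2 * b)"] True by (simp add: field_simps)
  qed
  then show ?thesis using True by simp
next
  case False
  have "a > 0" using False \<open>0 \<le> a\<close> by simp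
  have "0 \<le> a * (c + 2 * (- b / a) * b + (- b / a)\<^sup>2 * a)"
    using assms(1)[of "- b / a"] \<open>a > 0\<close> by (intro mult_nonneg_nonneg) auto
  also have "\<dots> = a * c - b\<^sup>2"
    using \<open>a > 0\<close> by (simp add: field_simps power2_eq_square)
  finally show ?thesis by simp
qed

lemma bilin_Cauchy_Schwarz:
  assumes "f \<in> H1_graph \<Gamma>" "g \<in> H1_graph \<Gamma>"
  shows "\<bar>bilin \<Gamma> c0 f g\<bar> \<le> sqrt (bilin \<Gamma> c0 f f) * sqrt (bilin \<Gamma> c0 g g)"
proof -
  have "(bilin \<Gamma> c0 f g)\<^sup>2 \<le> bilin \<Gamma> c0 g g * bilin \<Gamma> c0 f f"
  proof (rule quadratic_nonneg_discriminant)
    show "0 \<le> bilin \<Gamma> c0 f f + 2 * t * bilin \<Gamma> c0 f g + t\<^sup>2 * bilin \<Gamma> c0 g g" for t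
      using bilin_nonneg[OF H1_graph_add_scaled[OF assms, of t]] bilin_square_expand[OF assms, of
        t] by simp
  qed (rule bilin_nonneg[OF assms(2)])
  then have "sqrt ((bilin \<Gamma> c0 f g)\<^sup>2) \<le> sqrt (bilin \<Gamma> c0 g g * bilin \<Gamma> c0 f f)"
    by (rule real_sqrt_le_mono)
  then show ?thesis
    by (simp add: real_sqrt_mult mult.commute)
qed

text \<open>The error \<open>p - ph\<close> is orthogonal to \<open>ph - vh\<close>, so Pythagoras' theorem applies to their sum
  \<open>p - vh\<close>.\<close>

lemma galerkin_best_approximation:
  assumes p: "p \<in> H1_graph \<Gamma>" and ph: "ph \<in> VhD \<Gamma> VD n" and vh: "vh \<in> VhD \<Gamma> VD n"
    and orth: "\<forall>wh\<in>VhD \<Gamma> VD n. bilin \<Gamma> c0 wh (\<lambda>e x. p e x - ph e x) = 0"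
  shows "bilin \<Gamma> c0 (\<lambda>e x. p e x - ph e x) (\<lambda>e x. p e x - ph e x)
    \<le> bilin \<Gamma> c0 (\<lambda>e x. p e x - vh e x) (\<lambda>e x. p e x - vh e x)"
proof -
  define s where "s = (\<lambda>e x. ph e x - vh e x)"
  define r where "r = (\<lambda>e x. p e x - ph e x)"
  have s: "s \<in> VhD \<Gamma> VD n"
    unfolding s_def by (rule VhD_diff[OF ph vh])
  then have s_H1: "s \<in> H1_graph \<Gamma>"
    by (simp add: VhD_def H1D_graph_def)
  have r_H1: "r \<in> H1_graph \<Gamma>"
    unfolding r_def by (rule H1_graph_diff[OF p]) (use ph in \<open>simp add: VhD_def H1D_graph_def\<close>)
  have "bilin \<Gamma> c0 r s = 0"
    using orth s unfolding r_def by (subst bilin_commute) blast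
  then have "bilin \<Gamma> c0 (\<lambda>e x. r e x + 1 * s e x) (\<lambda>e x. r e x + 1 * s e x) =
      bilin \<Gamma> c0 r r + bilin \<Gamma> c0 s s"
    using bilin_square_expand[OF r_H1 s_H1, of 1] by simp
  moreover have "(\<lambda>e x. r e x + 1 * s e x) = (\<lambda>e x. p e x - vh e x)"
    by (simp add: r_def s_def)
  ultimately show ?thesis
    using bilin_nonneg[OF s_H1] by (simp add: r_def)
qed

section \<open>Finite element functions\<close>

lemma Vh_H1:
  assumes f: "f \<in> Vh \<Gamma> n" and n: "\<forall>e\<in>edges \<Gamma>. n e \<ge> 1"
  shows "f \<in> H1_graph \<Gamma>"
proof -
  have "\<exists>g. primitive_on (len \<Gamma> e) (f e) g" if e: "e \<in> edges \<Gamma>" for e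
  proof -
    have "\<forall>i\<in>{..<n e}. \<exists>\<alpha> \<beta>. \<forall>x\<in>{grid_point \<Gamma> n e i..grid_point \<Gamma> n e (Suc i)}. f e x = \<alpha> + \<beta> * x"
      using f e by (auto simp: Vh_def)
    then obtain \<alpha> \<beta> where aff: "\<And>i x. i < n e \<Longrightarrow>
        x \<in> {grid_point \<Gamma> n e i..grid_point \<Gamma> n e (Suc i)} \<Longrightarrow> f e x = \<alpha> i + \<beta> i * x"
      by (metis lessThan_iff)
    show ?thesis
      by (rule piecewise_affine_primitive[of "len \<Gamma> e" "n e" "f e" \<alpha> \<beta>])
        (use n e f aff in \<open>auto simp: grid_point_def Vh_def continuous_graph_fun_def\<close>)
  qed
  then obtain f' where "\<And>e. e \<in> edges \<Gamma> \<Longrightarrow> primitive_on (len \<Gamma> e) (f e) (f' e)"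
    by metis
  then show ?thesis
    using f by (intro H1_graphI) (auto simp: Vh_def)
qed

lemma VhDI:
  assumes "f \<in> Vh \<Gamma> n" "\<forall>e\<in>edges \<Gamma>. n e \<ge> 1" "\<forall>v\<in>VD. has_vertex_value \<Gamma> f v 0"
  shows "f \<in> VhD \<Gamma> VD n"
  using assms Vh_H1 by (simp add: VhD_def H1D_graph_def)

lemma graph_hat_interpolant_grid_point:
  assumes "e \<in> edges \<Gamma>" "1 \<le> n e" "i \<le> n e"
  shows "graph_hat_interpolant \<Gamma> n u e (grid_point \<Gamma> n e i) = u e i"
  using hat_interpolant_node[of "len \<Gamma> e" "n e" i "u e"] assms
  by (simp add: graph_hat_interpolant_def grid_point_def)

lemma graph_hat_interpolant_vertex_value:
  assumes n: "\<forall>e\<in>edges \<Gamma>. n e \<ge> 1"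
    and u: "\<And>e. e \<in> edges \<Gamma> \<Longrightarrow> (tail \<Gamma> e = v \<longrightarrow> u e 0 = c) \<and> (head \<Gamma> e = v \<longrightarrow> u e (n e) = c)"
  shows "has_vertex_value \<Gamma> (graph_hat_interpolant \<Gamma> n u) v c"
  unfolding has_vertex_value_def
proof
  fix e assume "e \<in> incident_edges \<Gamma> v"
  then have e: "e \<in> edges \<Gamma>" by (simp add: incident_edges_def)
  have "n e \<ge> 1" using n e by blast
  moreover have "grid_point \<Gamma> n e 0 = 0" "grid_point \<Gamma> n e (n e) = len \<Gamma> e"
    using \<open>n e \<ge> 1\<close> by (auto simp: grid_point_def)
  ultimately show "(tail \<Gamma> e = v \<longrightarrow> graph_hat_interpolant \<Gamma> n u e 0 = c) \<and>
      (head \<Gamma> e = v \<longrightarrow> graph_hat_interpolant \<Gamma> n u e (len \<Gamma> e) = c)"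
    using graph_hat_interpolant_grid_point[OF e, of n 0 u]
      graph_hat_interpolant_grid_point[OF e, of n "n e" u] u[OF e] by simp
qed

lemma graph_hat_interpolant_Vh:
  assumes n: "\<forall>e\<in>edges \<Gamma>. n e \<ge> 1"
    and u: "\<And>v. v \<in> verts \<Gamma> \<Longrightarrow> \<exists>c. has_vertex_value \<Gamma> (graph_hat_interpolant \<Gamma> n u) v c"
  shows "graph_hat_interpolant \<Gamma> n u \<in> Vh \<Gamma> n"
  unfolding Vh_def continuous_graph_fun_def
proof (intro CollectI conjI ballI allI impI)
  show "continuous_on {0..len \<Gamma> e} (graph_hat_interpolant \<Gamma> n u e)" for e
    unfolding graph_hat_interpolant_def by (rule hat_interpolant_continuous)
  fix e i assume e: "e \<in> edges \<Gamma>" and i: "i < n e"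
  let ?d = "u e (Suc i) - u e i"
  have "graph_hat_interpolant \<Gamma> n u e x = (u e i - ?d * real i) + (?d * real (n e) / len \<Gamma> e) * x"
    if "x \<in> {grid_point \<Gamma> n e i..grid_point \<Gamma> n e (Suc i)}" for x
    unfolding graph_hat_interpolant_def
    using hat_interpolant_cell[OF len_pos[OF e] i that[unfolded grid_point_def], of "u e"]
    by (simp add: field_simps)
  then show "\<exists>\<alpha> \<beta>. \<forall>x\<in>{grid_point \<Gamma> n e i..grid_point \<Gamma> n e (Suc i)}.
      graph_hat_interpolant \<Gamma> n u e x = \<alpha> + \<beta> * x"
    by blast
qed (use u in blast)

text \<open>The choice operator in \<open>nodal_basis\<close> is justified by the interpolant of the nodal values of the
  basis function. An edge with a single cell and a loop at \<open>v\<close> are covered: there both end points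
  carry the value 1 if they coincide with \<open>v\<close>.\<close>

lemma nodal_basis:
  assumes n: "\<forall>e\<in>edges \<Gamma>. n e \<ge> 1"
  shows "nodal_basis \<Gamma> n v \<in> Vh \<Gamma> n" "has_vertex_value \<Gamma> (nodal_basis \<Gamma> n v) v 1"
    "\<And>u. u \<in> verts \<Gamma> \<Longrightarrow> u \<noteq> v \<Longrightarrow> has_vertex_value \<Gamma> (nodal_basis \<Gamma> n v) u 0"
proof -
  define u where "u = (\<lambda>e j. if j = 0 \<and> tail \<Gamma> e = v \<or> j = n e \<and> head \<Gamma> e =
      v then 1 else 0 :: real)"
  define \<phi> where "\<phi> = graph_hat_interpolant \<Gamma> n u"
  have n': "n e \<noteq> 0" if "e \<in> edges \<Gamma>" for e
    using n that by force
  have val: "has_vertex_value \<Gamma> \<phi> w (if w = v then 1 else 0)" for w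
    unfolding \<phi>_def by (rule graph_hat_interpolant_vertex_value[OF n]) (auto simp: u_def dest: n')
  have "\<phi> \<in> Vh \<Gamma> n"
    unfolding \<phi>_def by (rule graph_hat_interpolant_Vh[OF n]) (use val in \<open>auto simp: \<phi>_def\<close>)
  moreover have "has_vertex_value \<Gamma> \<phi> v 1"
    using val[of v] by simp
  moreover have "\<forall>u\<in>verts \<Gamma> - {v}. has_vertex_value \<Gamma> \<phi> u 0"
  proof
    fix w assume "w \<in> verts \<Gamma> - {v}"
    then show "has_vertex_value \<Gamma> \<phi> w 0" using val[of w] by simp
  qed
  moreover have "\<forall>e\<in>edges \<Gamma>. \<forall>i\<in>{0<..<n e}. \<phi> e (grid_point \<Gamma> n e i) = 0"
    using graph_hat_interpolant_grid_point n by (auto simp: \<phi>_def u_def)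
  ultimately have "\<phi> \<in> Vh \<Gamma> n \<and> has_vertex_value \<Gamma> \<phi> v 1 \<and>
     (\<forall>u\<in>verts \<Gamma> - {v}. has_vertex_value \<Gamma> \<phi> u 0) \<and>
     (\<forall>e\<in>edges \<Gamma>. \<forall>i\<in>{0<..<n e}. \<phi> e (grid_point \<Gamma> n e i) = 0)"
    by blast
  from someI[where P = "\<lambda>\<phi>. \<phi> \<in> Vh \<Gamma> n \<and> has_vertex_value \<Gamma> \<phi> v 1 \<and>
     (\<forall>u\<in>verts \<Gamma> - {v}. has_vertex_value \<Gamma> \<phi> u 0) \<and>
     (\<forall>e\<in>edges \<Gamma>. \<forall>i\<in>{0<..<n e}. \<phi> e (grid_point \<Gamma> n e i) = 0)", OF this]
  show "nodal_basis \<Gamma> n v \<in> Vh \<Gamma> n" "has_vertex_value \<Gamma> (nodal_basis \<Gamma> n v) v 1"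
    "\<And>u. u \<in> verts \<Gamma> \<Longrightarrow> u \<noteq> v \<Longrightarrow> has_vertex_value \<Gamma> (nodal_basis \<Gamma> n v) u 0"
    unfolding nodal_basis_def[symmetric] by blast+
qed

lemma edge_hat_ends:
  assumes "e \<in> edges \<Gamma>"
  shows "edge_hat \<Gamma> v e 0 = (if tail \<Gamma> e = v then 1 else 0)"
    and "edge_hat \<Gamma> v e (len \<Gamma> e) = (if head \<Gamma> e = v then 1 else 0)"
  using len_pos[OF assms] by (auto simp: edge_hat_def)

lemma edge_hat_vertex_value: "has_vertex_value \<Gamma> (edge_hat \<Gamma> v) w (if w = v then 1 else 0)"
  using edge_hat_ends by (auto simp: has_vertex_value_def incident_edges_def)

lemma edge_hat_Vh: "edge_hat \<Gamma> v \<in> Vh \<Gamma> n"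
  unfolding Vh_def continuous_graph_fun_def
proof (intro CollectI conjI ballI allI impI)
  show "continuous_on {0..len \<Gamma> e} (edge_hat \<Gamma> v e)" if "e \<in> edges \<Gamma>" for e
  proof -
    have "edge_hat \<Gamma> v e = (\<lambda>x. edge_hat \<Gamma> v e 0 + (edge_hat \<Gamma> v e 1 - edge_hat \<Gamma> v e 0) * x)"
      by (rule ext) (rule edge_hat_affine)
    then show ?thesis
      by (rule ssubst) (intro continuous_intros)
  qed
  show "\<exists>c. has_vertex_value \<Gamma> (edge_hat \<Gamma> v) w c" for w
    using edge_hat_vertex_value by blast
  show "\<exists>\<alpha> \<beta>. \<forall>x\<in>{grid_point \<Gamma> n e i..grid_point \<Gamma> n e (Suc i)}. edge_hat \<Gamma> v e x = \<alpha> + \<beta> * x"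
    for e i
    by (intro exI ballI) (rule edge_hat_affine)
qed

lemma edge_hat_H1: "edge_hat \<Gamma> v \<in> H1_graph \<Gamma>"
  by (rule Vh_H1[OF edge_hat_Vh, of "\<lambda>_. 1"]) simp

text \<open>This is the step that allows trading the nodal basis function for a function with
  grid-independent energy.\<close>

lemma edge_hat_minus_nodal_basis:
  assumes n: "\<forall>e\<in>edges \<Gamma>. n e \<ge> 1"
  shows "(\<lambda>e x. edge_hat \<Gamma> v e x - nodal_basis \<Gamma> n v e x) \<in> VhD \<Gamma> VD n"
proof (rule VhDI[OF _ n])
  show "(\<lambda>e x. edge_hat \<Gamma> v e x - nodal_basis \<Gamma> n v e x) \<in> Vh \<Gamma> n"
    using Vh_add_scaled[OF edge_hat_Vh nodal_basis(1)[OF n], of v "-1" v] by simp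
  show "\<forall>w\<in>VD. has_vertex_value \<Gamma> (\<lambda>e x. edge_hat \<Gamma> v e x - nodal_basis \<Gamma> n v e x) w 0"
  proof
    fix w assume "w \<in> VD"
    then have "has_vertex_value \<Gamma> (nodal_basis \<Gamma> n v) w (if w = v then 1 else 0)"
      using nodal_basis(2,3)[OF n] VD by auto
    from has_vertex_value_add_scaled[OF edge_hat_vertex_value[of v w] this, of "-1"]
    show "has_vertex_value \<Gamma> (\<lambda>e x. edge_hat \<Gamma> v e x - nodal_basis \<Gamma> n v e x) w 0"
      by simp
  qed
qed

section \<open>Interpolation error on the graph\<close>

definition interpolant :: "('e \<Rightarrow> nat) \<Rightarrow> 'e graph_fun \<Rightarrow> 'e graph_fun" where
  "interpolant n p = graph_hat_interpolant \<Gamma> n (\<lambda>e i. p e (grid_point \<Gamma> n e i))"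

lemma interpolant_vertex_value:
  assumes n: "\<forall>e\<in>edges \<Gamma>. n e \<ge> 1" and p: "has_vertex_value \<Gamma> p v c"
  shows "has_vertex_value \<Gamma> (interpolant n p) v c"
  unfolding interpolant_def
proof (rule graph_hat_interpolant_vertex_value[OF n])
  fix e assume e: "e \<in> edges \<Gamma>"
  then have "n e \<ge> 1" using n by blast
  then have "grid_point \<Gamma> n e 0 = 0" "grid_point \<Gamma> n e (n e) = len \<Gamma> e"
    by (auto simp: grid_point_def)
  then show "(tail \<Gamma> e = v \<longrightarrow> p e (grid_point \<Gamma> n e 0) = c) \<and>
      (head \<Gamma> e = v \<longrightarrow> p e (grid_point \<Gamma> n e (n e)) = c)"
    using p e by (simp add: has_vertex_value_def incident_edges_def)
qed

lemma interpolant_VhD: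
  assumes n: "\<forall>e\<in>edges \<Gamma>. n e \<ge> 1" and p: "p \<in> H1D_graph \<Gamma> VD"
  shows "interpolant n p \<in> VhD \<Gamma> VD n"
proof (rule VhDI[OF _ n])
  show "interpolant n p \<in> Vh \<Gamma> n"
    unfolding interpolant_def
  proof (rule graph_hat_interpolant_Vh[OF n])
    fix v assume "v \<in> verts \<Gamma>"
    then obtain c where "has_vertex_value \<Gamma> p v c"
      using p by (auto simp: H1D_graph_def H1_graph_def continuous_graph_fun_def)
    then show "\<exists>c. has_vertex_value \<Gamma> (graph_hat_interpolant \<Gamma> n (\<lambda>e i. p e (grid_point \<Gamma> n e
        i))) v c"
      using interpolant_vertex_value[OF n] unfolding interpolant_def by blast
  qed
  show "\<forall>v\<in>VD. has_vertex_value \<Gamma> (interpolant n p) v 0"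
    using p interpolant_vertex_value[OF n] by (auto simp: H1D_graph_def)
qed

lemma H2_graph_primitives:
  assumes "p \<in> H2_graph \<Gamma>"
  obtains q where "\<And>e. e \<in> edges \<Gamma> \<Longrightarrow> primitive_on (len \<Gamma> e) (p e) (q e)"
    "\<And>e. e \<in> edges \<Gamma> \<Longrightarrow> primitive_on (len \<Gamma> e) (q e) (graph_deriv \<Gamma> (graph_deriv \<Gamma> p) e)"
proof -
  have "\<exists>q. primitive_on (len \<Gamma> e) (p e) q \<and>
      primitive_on (len \<Gamma> e) q (graph_deriv \<Gamma> (graph_deriv \<Gamma> p) e)" if e: "e \<in> edges \<Gamma>" for e
  proof -
    have "p e \<in> H2_ivl (len \<Gamma> e)" "continuous_on {0..len \<Gamma> e} (p e)"
      using assms e H1_edge_continuous[of p e] by (auto simp: H2_graph_def)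
    from H2_primitives[OF this len_pos[OF e]] show ?thesis
      by blast
  qed
  then show thesis
    using that by metis
qed

lemma mesh_size_ge:
  assumes "e \<in> edges \<Gamma>"
  shows "len \<Gamma> e / real (n e) \<le> mesh_size \<Gamma> n"
  unfolding mesh_size_def using assms by (intro Max_ge) auto

lemma H2_seminorm_nonneg: "0 \<le> H2_seminorm \<Gamma> p"
  unfolding H2_seminorm_def L2_inner_def
  by (intro real_sqrt_ge_zero sum_nonneg integral_nonneg_AE AE_I2) simp

text \<open>On a graph without edges, \<open>mesh_size\<close> is the maximum of the empty set, about which nothing is
  known; but then the seminorm vanishes.\<close>

lemma mesh_size_H2_seminorm_nonneg: "0 \<le> mesh_size \<Gamma> n * H2_seminorm \<Gamma> p"
proof (cases "edges \<Gamma> = {}")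
  case True
  then show ?thesis
    by (simp add: H2_seminorm_def L2_inner_def)
next
  case False
  then obtain e where e: "e \<in> edges \<Gamma>" by blast
  have "0 \<le> len \<Gamma> e / real (n e)"
    using len_pos[OF e] by simp
  then have "0 \<le> mesh_size \<Gamma> n"
    using mesh_size_ge[OF e, of n] by linarith
  then show ?thesis
    using H2_seminorm_nonneg by simp
qed

lemma interpolant_energy_error:
  obtains K where "0 \<le> K" "\<And>n p. (\<forall>e\<in>edges \<Gamma>. n e \<ge> 1) \<Longrightarrow> p \<in> H2_graph \<Gamma> \<Longrightarrow>
    sqrt (bilin \<Gamma> c0 (\<lambda>e x. p e x - interpolant n p e x) (\<lambda>e x. p e x - interpolant n p e x))
      \<le> K * mesh_size \<Gamma> n * H2_seminorm \<Gamma> p"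
proof -
  \<comment> \<open>\<open>Q e K\<close>: the constant \<open>K\<close> works for the interpolation on the edge \<open>e\<close>. It is stated as a
    predicate in order to choose one constant for each edge; their sum works for all edges.\<close>
  define Q where "Q = (\<lambda>e K. 0 \<le> K \<and> (\<forall>N f q r d. 1 \<le> N \<longrightarrow>
    primitive_on (len \<Gamma> e) f q \<longrightarrow> primitive_on (len \<Gamma> e) q r \<longrightarrow>
    d = (\<lambda>x. f x - hat_interpolant N (len \<Gamma> e) (\<lambda>i. f (real i * len \<Gamma> e / real N)) x) \<longrightarrow>
    (\<exists>d'. primitive_on (len \<Gamma> e) d d' \<and>
      (LINT x|edge_measure (len \<Gamma> e). d' x * d' x + c0 e x * d x * d x) \<le>
        K * (len \<Gamma> e / real N)\<^sup>2 * (LINT x|edge_measure (len \<Gamma> e). (r x)\<^sup>2))))"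
  have "\<forall>e\<in>edges \<Gamma>. \<exists>K. Q e K"
  proof
    fix e assume e: "e \<in> edges \<Gamma>"
    show "\<exists>K. Q e K"
      by (rule interpolation_energy_error[OF c0_edge[OF e] len_pos[OF e]]) (unfold Q_def, blast)
  qed
  then obtain K where "\<forall>e\<in>edges \<Gamma>. Q e (K e)"
    by (auto dest: bchoice)
  then have K0: "\<And>e. e \<in> edges \<Gamma> \<Longrightarrow> 0 \<le> K e"
    and K: "\<And>e N f q r d. e \<in> edges \<Gamma> \<Longrightarrow> 1 \<le> N \<Longrightarrow>
      primitive_on (len \<Gamma> e) f q \<Longrightarrow> primitive_on (len \<Gamma> e) q r \<Longrightarrow>
      d = (\<lambda>x. f x - hat_interpolant N (len \<Gamma> e) (\<lambda>i. f (real i * len \<Gamma> e / real N)) x) \<Longrightarrow>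
      \<exists>d'. primitive_on (len \<Gamma> e) d d' \<and>
        (LINT x|edge_measure (len \<Gamma> e). d' x * d' x + c0 e x * d x * d x) \<le>
          K e * (len \<Gamma> e / real N)\<^sup>2 * (LINT x|edge_measure (len \<Gamma> e). (r x)\<^sup>2)"
    unfolding Q_def by blast+
  define C where "C = (\<Sum>e\<in>edges \<Gamma>. K e)"
  have C: "0 \<le> C" "\<And>e. e \<in> edges \<Gamma> \<Longrightarrow> K e \<le> C"
    using K0 by (auto simp: C_def intro!: sum_nonneg member_le_sum)
  have "sqrt (bilin \<Gamma> c0 (\<lambda>e x. p e x - interpolant n p e x) (\<lambda>e x. p e x - interpolant n p e x))
      \<le> sqrt C * mesh_size \<Gamma> n * H2_seminorm \<Gamma> p"
    if n: "\<forall>e\<in>edges \<Gamma>. n e \<ge> 1" and p: "p \<in> H2_graph \<Gamma>" for n p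
  proof -
    let ?h = "mesh_size \<Gamma> n"
    let ?r = "graph_deriv \<Gamma> (graph_deriv \<Gamma> p)"
    define d where "d = (\<lambda>e x. p e x - interpolant n p e x)"
    obtain q where q: "\<And>e. e \<in> edges \<Gamma> \<Longrightarrow> primitive_on (len \<Gamma> e) (p e) (q e)"
      "\<And>e. e \<in> edges \<Gamma> \<Longrightarrow> primitive_on (len \<Gamma> e) (q e) (?r e)"
      using H2_graph_primitives[OF p] by blast
    have "\<exists>d'. primitive_on (len \<Gamma> e) (d e) d' \<and>
      (LINT x|edge_measure (len \<Gamma> e). d' x * d' x + c0 e x * d e x * d e x) \<le>
        K e * (len \<Gamma> e / real (n e))\<^sup>2 * (LINT x|edge_measure (len \<Gamma> e). (?r e x)\<^sup>2)"
          if e: "e \<in> edges \<Gamma>" for e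
    proof -
      have "d e = (\<lambda>x. p e x
        - hat_interpolant (n e) (len \<Gamma> e) (\<lambda>i. p e (real i * len \<Gamma> e / real (n e))) x)"
        by (simp add: d_def interpolant_def graph_hat_interpolant_def grid_point_def)
      then show ?thesis
        using n e by (intro K[OF e _ q(1)[OF e] q(2)[OF e]]) auto
    qed
    then have "\<forall>e\<in>edges \<Gamma>. \<exists>d'. primitive_on (len \<Gamma> e) (d e) d' \<and>
      (LINT x|edge_measure (len \<Gamma> e). d' x * d' x + c0 e x * d e x * d e x) \<le>
        K e * (len \<Gamma> e / real (n e))\<^sup>2 * (LINT x|edge_measure (len \<Gamma> e). (?r e x)\<^sup>2)"
      by blast
    from bchoice[OF this] obtain d'
      where d': "\<And>e. e \<in> edges \<Gamma> \<Longrightarrow> primitive_on (len \<Gamma> e) (d e) (d' e)"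
      and est: "\<And>e. e \<in> edges \<Gamma> \<Longrightarrow>
        (LINT x|edge_measure (len \<Gamma> e). d' e x * d' e x + c0 e x * d e x * d e x) \<le>
        K e * (len \<Gamma> e / real (n e))\<^sup>2 * (LINT x|edge_measure (len \<Gamma> e). (?r e x)\<^sup>2)"
      by blast
    have "bilin \<Gamma> c0 d d =
        (\<Sum>e\<in>edges \<Gamma>. LINT x|edge_measure (len \<Gamma> e). d' e x * d' e x + c0 e x * d e x * d e x)"
      by (rule bilin_primitives[OF d' d'])
    also have "\<dots> \<le> (\<Sum>e\<in>edges \<Gamma>. C * ?h\<^sup>2 * (LINT x|edge_measure (len \<Gamma> e). (?r e x)\<^sup>2))"
    proof (rule sum_mono)
      fix e assume e: "e \<in> edges \<Gamma>"
      have "K e * (len \<Gamma> e / real (n e))\<^sup>2 \<le> C * ?h\<^sup>2"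
        using C e mesh_size_ge[OF e, of n] less_imp_le[OF len_pos[OF e]]
        by (intro mult_mono power_mono) auto
      then have "K e * (len \<Gamma> e / real (n e))\<^sup>2 * (LINT x|edge_measure (len \<Gamma> e). (?r e x)\<^sup>2)
          \<le> C * ?h\<^sup>2 * (LINT x|edge_measure (len \<Gamma> e). (?r e x)\<^sup>2)"
        by (rule mult_right_mono) simp
      then show "(LINT x|edge_measure (len \<Gamma> e). d' e x * d' e x + c0 e x * d e x * d e x)
          \<le> C * ?h\<^sup>2 * (LINT x|edge_measure (len \<Gamma> e). (?r e x)\<^sup>2)"
        using est[OF e] by linarith
    qed
    also have "\<dots> = C * ?h\<^sup>2 * L2_inner \<Gamma> ?r ?r"
      by (simp add: L2_inner_def sum_distrib_left power2_eq_square)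
    finally have "sqrt (bilin \<Gamma> c0 d d) \<le> sqrt (C * ?h\<^sup>2 * L2_inner \<Gamma> ?r ?r)"
      by (rule real_sqrt_le_mono)
    also have "\<dots> = sqrt C * \<bar>?h\<bar> * H2_seminorm \<Gamma> p"
      by (simp add: real_sqrt_mult H2_seminorm_def)
    also have "\<dots> = sqrt C * ?h * H2_seminorm \<Gamma> p"
      using mesh_size_H2_seminorm_nonneg[of n p] H2_seminorm_nonneg[of p]
      by (metis abs_mult abs_of_nonneg mult.assoc)
    finally show ?thesis
      by (simp add: d_def)
  qed
  then show thesis
    using C(1) by (intro that[of "sqrt C"]) auto
qed

section \<open>Variational form of the Kirchhoff operators\<close>

text \<open>A test function on the edge \<open>e\<close>, extended by zero, is an admissible function on the graph. With it
  the weak equation says that the weak derivative of \<open>q = p'\<close> is \<open>c\<^sub>0 p - y\<close>.\<close>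

lemma strong_form:
  assumes y: "y \<in> L2_graph \<Gamma>" and e: "e \<in> edges \<Gamma>"
    and weak: "\<forall>w\<in>H1D_graph \<Gamma> VD. bilin \<Gamma> c0 w p = L2_inner \<Gamma> y w"
    and p: "\<And>e. e \<in> edges \<Gamma> \<Longrightarrow> primitive_on (len \<Gamma> e) (p e) (q e)"
    and q: "primitive_on (len \<Gamma> e) (q e) r"
  shows "AE x in edge_measure (len \<Gamma> e). c0 e x * p e x - r x - y e x = 0"
proof (rule fundamental_lemma)
  have L2: "p e \<in> L2_ivl (len \<Gamma> e)" "q e \<in> L2_ivl (len \<Gamma> e)" "r \<in> L2_ivl (len \<Gamma> e)"
    "(\<lambda>x. c0 e x * p e x) \<in> L2_ivl (len \<Gamma> e)" "y e \<in> L2_ivl (len \<Gamma> e)"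
    using primitive_on_continuous[OF p[OF e], THEN continuous_L2] primitive_onD(1)[OF p[OF e]]
      primitive_onD(1)[OF q] y e Linf_mult_L2[OF c0_edge[OF e]] by (auto simp: L2_graph_def)
  then show "integrable (edge_measure (len \<Gamma> e)) (\<lambda>x. c0 e x * p e x - r x - y e x)"
    by (intro Bochner_Integration.integrable_diff L2_integrable)
  fix \<eta> assume \<eta>: "\<eta> \<in> test_functions (len \<Gamma> e)"
  define w where "w = (\<lambda>e'. if e' = e then \<eta> else (\<lambda>x. 0))"
  define w' where "w' = (\<lambda>e'. if e' = e then deriv \<eta> else (\<lambda>x. 0))"
  have w: "primitive_on (len \<Gamma> e') (w e') (w' e')" if "e' \<in> edges \<Gamma>" for e'
    using test_function_primitive[OF \<eta>] zero_primitive by (simp add: w_def w'_def)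
  have "has_vertex_value \<Gamma> w v 0" for v
    using test_functionD(3)[OF \<eta>] by (auto simp: has_vertex_value_def w_def)
  moreover have "continuous_on {0..len \<Gamma> e'} (w e')" if "e' \<in> edges \<Gamma>" for e'
    by (rule primitive_on_continuous[OF w[OF that]])
  ultimately have "w \<in> H1D_graph \<Gamma> VD"
    using H1_graphI[OF _ w] by (auto simp: H1D_graph_def continuous_graph_fun_def)
  then have "bilin \<Gamma> c0 w p = L2_inner \<Gamma> y w"
    using weak by blast
  moreover have "bilin \<Gamma> c0 w p =
      (LINT x|edge_measure (len \<Gamma> e). deriv \<eta> x * q e x + c0 e x * \<eta> x * p e x)"
  proof -
    have "bilin \<Gamma> c0 w p =
        (\<Sum>e'\<in>edges \<Gamma>. LINT x|edge_measure (len \<Gamma> e'). w' e' x * q e' x + c0 e' x * w e' x * p e' x)"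
      by (rule bilin_primitives[OF w p])
    also have "\<dots> = (\<Sum>e'\<in>edges \<Gamma>. if e' = e
        then LINT x|edge_measure (len \<Gamma> e). deriv \<eta> x * q e x + c0 e x * \<eta> x * p e x else 0)"
      by (rule sum.cong[OF refl]) (simp add: w_def w'_def)
    finally show ?thesis
      using e by simp
  qed
  moreover have "L2_inner \<Gamma> y w = (LINT x|edge_measure (len \<Gamma> e). y e x * \<eta> x)"
  proof -
    have "L2_inner \<Gamma> y w = (\<Sum>e'\<in>edges \<Gamma>. if e' =
        e then LINT x|edge_measure (len \<Gamma> e). y e x * \<eta> x else 0)"
      unfolding L2_inner_def by (rule sum.cong[OF refl]) (simp add: w_def)
    then show ?thesis
      using e by simp
  qed
  moreover have "(LINT x|edge_measure (len \<Gamma> e). deriv \<eta> x * q e x + c0 e x * \<eta> x * p e x) =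
      (LINT x|edge_measure (len \<Gamma> e). q e x * deriv \<eta> x)
        + (LINT x|edge_measure (len \<Gamma> e). c0 e x * p e x * \<eta> x)"
  proof -
    have "primitive_on (len \<Gamma> e) \<eta> (deriv \<eta>)"
      by (rule test_function_primitive[OF \<eta>])
    from energy_integrable(1,2)[OF e this p[OF e]] show ?thesis
      by (simp add: mult_ac)
  qed
  moreover have "(LINT x|edge_measure (len \<Gamma> e). q e x * deriv \<eta> x) =
      - (LINT x|edge_measure (len \<Gamma> e). r x * \<eta> x)"
    using primitive_on_weak_deriv[OF q len_pos[OF e]] \<eta> by (simp add: is_weak_deriv_def)
  moreover have "(LINT x|edge_measure (len \<Gamma> e). (c0 e x * p e x - r x - y e x) * \<eta> x) =
      (LINT x|edge_measure (len \<Gamma> e). c0 e x * p e x * \<eta> x)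
        - (LINT x|edge_measure (len \<Gamma> e). r x * \<eta> x)
      - (LINT x|edge_measure (len \<Gamma> e). y e x * \<eta> x)"
  proof -
    have "\<eta> \<in> L2_ivl (len \<Gamma> e)"
      using \<eta> by (intro continuous_L2 test_function_continuous)
    then show ?thesis
      using L2_mult_integrable[OF L2(3)] L2_mult_integrable[OF L2(4)] L2_mult_integrable[OF L2(5)]
      by (simp add: left_diff_distrib)
  qed
  ultimately show "(LINT x|edge_measure (len \<Gamma> e). (c0 e x * p e x - r x - y e x) * \<eta> x) = 0"
    by linarith
qed

text \<open>Integration by parts on each edge leaves the boundary terms \<open>q L * w L - q 0 * w 0\<close> and an
  integral that vanishes by the strong form. The values of \<open>w\<close> at the end points select exactly the
  outward derivatives at \<open>v\<close>.\<close>

lemma kirchhoff_variational: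
  assumes y: "y \<in> L2_graph \<Gamma>" and p: "p \<in> H2_graph \<Gamma>"
    and weak: "\<forall>w\<in>H1D_graph \<Gamma> VD. bilin \<Gamma> c0 w p = L2_inner \<Gamma> y w"
  shows "kirchhoff \<Gamma> p v = bilin \<Gamma> c0 (edge_hat \<Gamma> v) p - L2_inner \<Gamma> y (edge_hat \<Gamma> v)"
proof -
  let ?r = "graph_deriv \<Gamma> (graph_deriv \<Gamma> p)"
  let ?w = "edge_hat \<Gamma> v"
  define s where "s = (\<lambda>e. ?w e 1 - ?w e 0)"
  obtain q where q: "\<And>e. e \<in> edges \<Gamma> \<Longrightarrow> primitive_on (len \<Gamma> e) (p e) (q e)"
    "\<And>e. e \<in> edges \<Gamma> \<Longrightarrow> primitive_on (len \<Gamma> e) (q e) (?r e)"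
    using H2_graph_primitives[OF p] by blast
  have w': "(?w e has_real_derivative s e) (at x within S)" for e x S
  proof -
    have "?w e = (\<lambda>x. ?w e 0 + s e * x)"
      unfolding s_def by (rule ext) (rule edge_hat_affine)
    then show ?thesis
      by (rule ssubst) (auto intro!: derivative_eq_intros)
  qed
  have w: "primitive_on (len \<Gamma> e) (?w e) (\<lambda>x. s e)" for e
    by (rule C1_primitive[OF w' continuous_on_const])
  have edge_identity: "(LINT x|edge_measure (len \<Gamma> e). s e * q e x + c0 e x * ?w e x * p e x)
      - (LINT x|edge_measure (len \<Gamma> e). y e x * ?w e x)
      = (if head \<Gamma> e = v then q e (len \<Gamma> e) else 0) + (if tail \<Gamma> e = v then - q e 0 else 0)"
    if e: "e \<in> edges \<Gamma>" for e
  proof -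
    let ?M = "edge_measure (len \<Gamma> e)"
    have L2: "?w e \<in> L2_ivl (len \<Gamma> e)" "?r e \<in> L2_ivl (len \<Gamma> e)" "y e \<in> L2_ivl (len \<Gamma> e)"
      using primitive_on_continuous[OF w, THEN continuous_L2] primitive_onD(1)[OF q(2)[OF e]] y e
      by (auto simp: L2_graph_def)
    note int = energy_integrable(1,2)[OF e w[of e] q(1)[OF e]]
      L2_mult_integrable[OF L2(2,1)] L2_mult_integrable[OF L2(3,1)]
    have parts: "(LINT x|?M. q e x * s e) =
        q e (len \<Gamma> e) * ?w e (len \<Gamma> e) - q e 0 * ?w e 0 - (LINT x|?M. ?r e x * ?w e x)"
      by (rule integration_by_parts_edge[OF primitive_onD(1)[OF q(2)[OF e]] len_pos[OF e]
            primitive_onD(2)[OF q(2)[OF e]] w' continuous_on_const])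
    have "AE x in ?M. c0 e x * p e x - ?r e x - y e x = 0"
      by (rule strong_form[OF y e weak q(1) q(2)[OF e]])
    then have "AE x in ?M. c0 e x * ?w e x * p e x - ?r e x * ?w e x - y e x * ?w e x = 0"
    proof eventually_elim
      case (elim x)
      have "c0 e x * ?w e x * p e x - ?r e x * ?w e x - y e x * ?w e x
          = ?w e x * (c0 e x * p e x - ?r e x - y e x)"
        by (simp add: algebra_simps)
      then show ?case using elim by simp
    qed
    then have "(LINT x|?M. c0 e x * ?w e x * p e x - ?r e x * ?w e x - y e x * ?w e x) = 0"
      by (rule integral_eq_zero_AE)
    then have residual: "(LINT x|?M. c0 e x * ?w e x * p e x) - (LINT x|?M. ?r e x * ?w e x)
        - (LINT x|?M. y e x * ?w e x) = 0"
      using int(2-4) by simp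
    have "(LINT x|?M. s e * q e x + c0 e x * ?w e x * p e x)
        = (LINT x|?M. q e x * s e) + (LINT x|?M. c0 e x * ?w e x * p e x)"
      using int(1,2) by (simp add: mult.commute[of "s e"])
    then show ?thesis
      using parts residual edge_hat_ends[OF e, of v] by auto
  qed
  have "bilin \<Gamma> c0 ?w p - L2_inner \<Gamma> y ?w =
      (\<Sum>e\<in>edges \<Gamma>. (LINT x|edge_measure (len \<Gamma> e). s e * q e x + c0 e x * ?w e x * p e x)
        - (LINT x|edge_measure (len \<Gamma> e). y e x * ?w e x))"
    unfolding L2_inner_def sum_subtractf by (subst bilin_primitives[OF w q(1)]) auto
  also have "\<dots> = (\<Sum>e\<in>edges \<Gamma>. (if head \<Gamma> e = v then q e (len \<Gamma> e) else 0) +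
      (if tail \<Gamma> e = v then - q e 0 else 0))"
    by (rule sum.cong[OF refl edge_identity])
  also have "\<dots> = (\<Sum>e\<in>incident_edges \<Gamma> v. (if head \<Gamma> e = v then q e (len \<Gamma> e) else 0) +
      (if tail \<Gamma> e = v then - q e 0 else 0))"
    by (rule sum.mono_neutral_right) (auto simp: incident_edges_def)
  also have "\<dots> = kirchhoff \<Gamma> p v"
    unfolding kirchhoff_def
  proof (rule sum.cong[OF refl])
    fix e assume "e \<in> incident_edges \<Gamma> v"
    then have e: "e \<in> edges \<Gamma>" by (simp add: incident_edges_def)
    have "vector_derivative (p e) (at x within {0..len \<Gamma> e}) = q e x" if "x \<in> {0..len \<Gamma> e}" for x
      by (rule vector_derivative_within_closed_interval[OF len_pos[OF e] that
            primitive_has_vector_derivative[OF q(1)[OF e] primitive_on_continuous[OF q(2)[OF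
              e]] that]])
    then show "(if head \<Gamma> e = v then q e (len \<Gamma> e) else 0) + (if tail \<Gamma> e = v then - q e 0 else 0) =
        (if head \<Gamma> e = v then vector_derivative (p e) (at (len \<Gamma> e) within {0..len \<Gamma> e}) else 0) +
        (if tail \<Gamma> e = v then - vector_derivative (p e) (at 0 within {0..len \<Gamma> e}) else 0)"
      using len_pos[OF e] by simp
  qed
  finally show ?thesis ..
qed

lemma L2_inner_diff_right:
  assumes "y \<in> L2_graph \<Gamma>" "f \<in> H1_graph \<Gamma>" "g \<in> H1_graph \<Gamma>"
  shows "L2_inner \<Gamma> y (\<lambda>e x. f e x - g e x) = L2_inner \<Gamma> y f - L2_inner \<Gamma> y g"
  unfolding L2_inner_def sum_subtractf[symmetric]
proof (rule sum.cong[OF refl])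
  fix e assume e: "e \<in> edges \<Gamma>"
  have "y e \<in> L2_ivl (len \<Gamma> e)" "f e \<in> L2_ivl (len \<Gamma> e)" "g e \<in> L2_ivl (len \<Gamma> e)"
    using assms e by (auto simp: L2_graph_def H1_graph_def H1_ivl_def)
  then show "(LINT x|edge_measure (len \<Gamma> e). y e x * (f e x - g e x)) =
      (LINT x|edge_measure (len \<Gamma> e). y e x * f e x)
        - (LINT x|edge_measure (len \<Gamma> e). y e x * g e x)"
    by (simp add: right_diff_distrib L2_mult_integrable)
qed

text \<open>Let \<open>g\<close> be the difference of \<open>edge_hat\<close> and the nodal basis function. It is an admissible test
  function for both problems, so \<open>a(g, ph) = a(g, p) = (y, g)\<close>: the contribution of \<open>g\<close> to the
  definition of \<open>kirchhoff_h\<close> cancels.\<close>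

lemma kirchhoff_h_variational:
  assumes n: "\<forall>e\<in>edges \<Gamma>. n e \<ge> 1" and y: "y \<in> L2_graph \<Gamma>" and p: "p \<in> H1_graph \<Gamma>"
    and weak: "\<forall>w\<in>H1D_graph \<Gamma> VD. bilin \<Gamma> c0 w p = L2_inner \<Gamma> y w"
    and ph: "ph \<in> VhD \<Gamma> VD n"
    and orth: "\<forall>wh\<in>VhD \<Gamma> VD n. bilin \<Gamma> c0 wh (\<lambda>e x. p e x - ph e x) = 0"
  shows "kirchhoff_h \<Gamma> c0 n y ph v = bilin \<Gamma> c0 (edge_hat \<Gamma> v) ph - L2_inner \<Gamma> y (edge_hat \<Gamma> v)"
proof -
  let ?\<phi> = "nodal_basis \<Gamma> n v" and ?w = "edge_hat \<Gamma> v"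
  define g where "g = (\<lambda>e x. ?w e x - ?\<phi> e x)"
  have ph_H1: "ph \<in> H1_graph \<Gamma>"
    using ph by (simp add: VhD_def H1D_graph_def)
  have \<phi>_H1: "?\<phi> \<in> H1_graph \<Gamma>"
    by (rule Vh_H1[OF nodal_basis(1)[OF n] n])
  have g: "g \<in> VhD \<Gamma> VD n"
    unfolding g_def by (rule edge_hat_minus_nodal_basis[OF n])
  then have g_H1: "g \<in> H1D_graph \<Gamma> VD" "g \<in> H1_graph \<Gamma>"
    by (auto simp: VhD_def H1D_graph_def)
  have "bilin \<Gamma> c0 g p - bilin \<Gamma> c0 g ph = 0"
    using orth g bilin_diff_right[OF p ph_H1 g_H1(2)] by simp
  moreover have "bilin \<Gamma> c0 g p = L2_inner \<Gamma> y g"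
    using weak g_H1(1) by blast
  ultimately have "bilin \<Gamma> c0 g ph = L2_inner \<Gamma> y g"
    by simp
  moreover have "bilin \<Gamma> c0 g ph = bilin \<Gamma> c0 ?w ph - bilin \<Gamma> c0 ?\<phi> ph"
    unfolding g_def bilin_commute[of _ ph] by (rule bilin_diff_right[OF edge_hat_H1 \<phi>_H1 ph_H1])
  moreover have "L2_inner \<Gamma> y g = L2_inner \<Gamma> y ?w - L2_inner \<Gamma> y ?\<phi>"
    unfolding g_def by (rule L2_inner_diff_right[OF y edge_hat_H1 \<phi>_H1])
  ultimately show ?thesis
    by (simp add: kirchhoff_h_def)
qed

lemma kirchhoff_error_energy:
  assumes n: "\<forall>e\<in>edges \<Gamma>. n e \<ge> 1" and y: "y \<in> L2_graph \<Gamma>" and H2: "p \<in> H2_graph \<Gamma>"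
    and weak: "\<forall>w\<in>H1D_graph \<Gamma> VD. bilin \<Gamma> c0 w p = L2_inner \<Gamma> y w"
    and ph: "ph \<in> VhD \<Gamma> VD n"
    and orth: "\<forall>wh\<in>VhD \<Gamma> VD n. bilin \<Gamma> c0 wh (\<lambda>e x. p e x - ph e x) = 0"
  shows "\<bar>kirchhoff \<Gamma> p v - kirchhoff_h \<Gamma> c0 n y ph v\<bar> \<le>
    sqrt (bilin \<Gamma> c0 (edge_hat \<Gamma> v) (edge_hat \<Gamma> v)) *
    sqrt (bilin \<Gamma> c0 (\<lambda>e x. p e x - ph e x) (\<lambda>e x. p e x - ph e x))"
proof -
  have H1: "p \<in> H1_graph \<Gamma>" "ph \<in> H1_graph \<Gamma>"
    using H2 ph by (auto simp: H2_graph_def VhD_def H1D_graph_def)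
  have "kirchhoff \<Gamma> p v - kirchhoff_h \<Gamma> c0 n y ph v =
      bilin \<Gamma> c0 (edge_hat \<Gamma> v) (\<lambda>e x. p e x - ph e x)"
    using kirchhoff_variational[OF y H2 weak] kirchhoff_h_variational[OF n y H1(1) weak ph orth]
      bilin_diff_right[OF H1 edge_hat_H1] by simp
  then show ?thesis
    using bilin_Cauchy_Schwarz[OF edge_hat_H1 H1_graph_diff[OF H1], of v] by simp
qed

end

theorem theorem3p5:
  fixes \<Gamma> :: "('v, 'e) metric_graph" and VK VD :: "'v set" and c0 :: "'e graph_fun"
  assumes "is_metric_graph \<Gamma>"
    and "verts \<Gamma> = VK \<union> VD" and "VK \<inter> VD = {}"
    and "c0 \<in> Linf_graph \<Gamma>"
    and "\<forall>e\<in>edges \<Gamma>. AE x in lebesgue_on {0<..<len \<Gamma> e}. c0 e x \<ge> 0"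
    and "coercive_on_H1D \<Gamma> VD c0"
  shows "\<exists>c>0. \<forall>(n :: 'e \<Rightarrow> nat) y p ph.
    (\<forall>e\<in>edges \<Gamma>. n e \<ge> 1) \<longrightarrow>
    y \<in> L2_graph \<Gamma> \<longrightarrow>
    p \<in> H1D_graph \<Gamma> VD \<longrightarrow>
    (\<forall>w\<in>H1D_graph \<Gamma> VD. bilin \<Gamma> c0 w p = L2_inner \<Gamma> y w) \<longrightarrow>
    ph \<in> VhD \<Gamma> VD n \<longrightarrow>
    (\<forall>wh\<in>VhD \<Gamma> VD n. bilin \<Gamma> c0 wh (\<lambda>e x. p e x - ph e x) = 0) \<longrightarrow>
    p \<in> H2_graph \<Gamma> \<longrightarrow>
    L2_set (\<lambda>v. kirchhoff \<Gamma> p v - kirchhoff_h \<Gamma> c0 n y ph v) VD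
      \<le> c * mesh_size \<Gamma> n * H2_seminorm \<Gamma> p"
proof -
  interpret graph_problem \<Gamma> VD c0
    using assms by unfold_locales auto
  obtain K where K: "0 \<le> K" and interp: "\<And>n p. (\<forall>e\<in>edges \<Gamma>. n e \<ge> 1) \<Longrightarrow> p \<in> H2_graph \<Gamma> \<Longrightarrow>
    sqrt (bilin \<Gamma> c0 (\<lambda>e x. p e x - interpolant n p e x) (\<lambda>e x. p e x - interpolant n p e x))
      \<le> K * mesh_size \<Gamma> n * H2_seminorm \<Gamma> p"
    by (rule interpolant_energy_error) blast
  define A where "A = (\<lambda>v. sqrt (bilin \<Gamma> c0 (edge_hat \<Gamma> v) (edge_hat \<Gamma> v)))"
  \<comment> \<open>The summand 1 only makes the constant positive.\<close>
  define c where "c = L2_set A VD * K + 1"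
  have "0 \<le> L2_set A VD * K"
    using K by (intro mult_nonneg_nonneg L2_set_nonneg)
  then have "c > 0" by (simp add: c_def)
  moreover have "L2_set (\<lambda>v. kirchhoff \<Gamma> p v - kirchhoff_h \<Gamma> c0 n y ph v) VD
      \<le> c * mesh_size \<Gamma> n * H2_seminorm \<Gamma> p"
    if n: "\<forall>e\<in>edges \<Gamma>. n e \<ge> 1" and y: "y \<in> L2_graph \<Gamma>" and p: "p \<in> H1D_graph \<Gamma> VD"
      and weak: "\<forall>w\<in>H1D_graph \<Gamma> VD. bilin \<Gamma> c0 w p = L2_inner \<Gamma> y w"
      and ph: "ph \<in> VhD \<Gamma> VD n"
      and orth: "\<forall>wh\<in>VhD \<Gamma> VD n. bilin \<Gamma> c0 wh (\<lambda>e x. p e x - ph e x) = 0"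
      and H2: "p \<in> H2_graph \<Gamma>" for n y p ph
  proof -
    define E where "E = sqrt (bilin \<Gamma> c0 (\<lambda>e x. p e x - ph e x) (\<lambda>e x. p e x - ph e x))"
    define B where "B = mesh_size \<Gamma> n * H2_seminorm \<Gamma> p"
    have H1: "p \<in> H1_graph \<Gamma>" "ph \<in> H1_graph \<Gamma>"
      using p ph by (auto simp: VhD_def H1D_graph_def)
    have "E \<le> sqrt (bilin \<Gamma> c0 (\<lambda>e x. p e x - interpolant n p e x) (\<lambda>e x. p e x
        - interpolant n p e x))"
      unfolding E_def
      by (rule real_sqrt_le_mono[OF galerkin_best_approximation[OF H1(1) ph interpolant_VhD[OF n
        p] orth]])
    also have "\<dots> \<le> K * B"
      using interp[OF n H2] by (simp add: B_def mult.assoc)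
    finally have E: "E \<le> K * B" .
    have "0 \<le> E"
      using bilin_nonneg[OF H1_graph_diff[OF H1]] by (simp add: E_def)
    have "0 \<le> B"
      unfolding B_def by (rule mesh_size_H2_seminorm_nonneg)
    have diff: "\<bar>kirchhoff \<Gamma> p v - kirchhoff_h \<Gamma> c0 n y ph v\<bar> \<le> A v * E" for v
      unfolding A_def E_def by (rule kirchhoff_error_energy[OF n y H2 weak ph orth])
    have "L2_set (\<lambda>v. kirchhoff \<Gamma> p v - kirchhoff_h \<Gamma> c0 n y ph v) VD
        = L2_set (\<lambda>v. \<bar>kirchhoff \<Gamma> p v - kirchhoff_h \<Gamma> c0 n y ph v\<bar>) VD"
      by (simp add: L2_set_def)
    also have "\<dots> \<le> L2_set (\<lambda>v. A v * E) VD"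
      by (rule L2_set_mono[OF diff]) simp
    also have "\<dots> = L2_set A VD * E"
      using \<open>0 \<le> E\<close> by (simp add: L2_set_left_distrib)
    also have "\<dots> \<le> L2_set A VD * (K * B)"
      by (rule mult_left_mono[OF E L2_set_nonneg])
    also have "\<dots> \<le> c * B"
      using \<open>0 \<le> B\<close> by (simp add: c_def algebra_simps)
    finally show ?thesis
      by (simp add: B_def mult.assoc)
  qed
  ultimately show ?thesis
    by blast
qed

end
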